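(* Let $A:\mathcal F_\lambda\otimes\mathcal F_\gamma\otimes\mathcal F_\tau\to\mathcal F_{\lambda+\gamma+\tau+3}$ be a $\mathfrak{vect}(1)$-invariant ternary differential operator of order $3$. Then, up to permutations and dualizations, $A$ is a multiple of one of the following operators, evaluated on $\varphi(dx)^\lambda\otimes\psi(dx)^\gamma\otimes\chi(dx)^\tau$, where the $\epsilon_i$ are constants: (1) for $(\gamma,\lambda,\tau)=(0,0,0)$: $\ \epsilon_1\{d\varphi,d\psi\}\chi+\epsilon_2\{d\chi,d\varphi\}\psi+\epsilon_3\{d\psi,d\chi\}\varphi+\epsilon_4\,d\varphi\cdot d\psi\cdot d\chi$; (2) for $\lambda=0$ and $\gamma^2+\tau^2\neq0$: $\ \epsilon_1\{\{d\varphi,\psi(dx)^\gamma\},\chi(dx)^\tau\}+\epsilon_2\{\{d\varphi,\chi(dx)^\tau\},\psi(dx)^\gamma\}$; (3) for $(\gamma,\lambda,\tau)=(-\frac23,-\frac23,-\frac23)$: $\ \epsilon_1\mathrm{Gz}(\varphi(dx)^{-2/3},\psi(dx)^{-2/3})\,\chi(dx)^{-2/3}+\epsilon_2\mathrm{Gz}(\chi(dx)^{-2/3},\varphi(dx)^{-2/3})\,\psi(dx)^{-2/3}+\epsilon_3\mathrm{Gz}(\psi(dx)^{-2/3},\chi(dx)^{-2/3})\,\varphi(dx)^{-2/3}$; (4) for $(\gamma,\lambda,\tau)=(-\frac12,-\frac12,-\frac12)$: $\ \epsilon_1\{d\{\varphi(dx)^{-1/2},\psi(dx)^{-1/2}\},\chi(dx)^{-1/2}\}+\epsilon_2\{d\{\chi(dx)^{-1/2},\varphi(dx)^{-1/2}\},\psi(dx)^{-1/2}\}+\epsilon_3\{d\{\psi(dx)^{-1/2},\chi(dx)^{-1/2}\},\varphi(dx)^{-1/2}\}$;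 (5) for $1+\lambda+\tau=0$ and $\gamma=\lambda\neq\tau$: $\ \epsilon_1\{d\{\varphi(dx)^\lambda,\chi(dx)^\tau\},\psi(dx)^\gamma\}+\epsilon_2\{d\{\psi(dx)^\gamma,\chi(dx)^\tau\},\varphi(dx)^\lambda\}$; (6) otherwise: $\ \Delta_{\lambda,\gamma,\tau;3}(\varphi(dx)^\lambda,\psi(dx)^\gamma,\chi(dx)^\tau)$.
   Context: For $\lambda\in\mathbb R$, $\mathcal F_\lambda=\{f(dx)^\lambda : f\in\mathbb R[x]\}$ is the space of weighted densities of weight $\lambda$ on $\mathbb R$. The Lie algebra $\mathfrak{vect}(1)$ of polynomial vector fields $X=h\frac{d}{dx}$, $h\in\mathbb R[x]$, acts on $\mathcal F_\lambda$ by $L_X(f(dx)^\lambda)=(hf'+\lambda h'f)(dx)^\lambda$. Densities are multiplied by $f(dx)^\lambda\cdot g(dx)^\mu=fg(dx)^{\lambda+\mu}$, and $\mathcal F_0$ is the space of functions. A ternary differential operator $A:\mathcal F_\lambda\otimes\mathcal F_\gamma\otimes\mathcal F_\tau\to\mathcal F_\mu$ is $\mathfrak{vect}(1)$-invariant if $L_X A(a,b,c)=A(L_Xa,b,c)+A(a,L_Xb,c)+A(a,b,L_Xc)$ for all $X\in\mathfrak{vect}(1)$. An invariant operator of order $k$ has the form $\varphi(dx)^\lambda\otimes\psi(dx)^\gamma\otimes\chi(dx)^\tau\mapsto\sum_{i+j+l=k}\alpha_{i,j,l}\varphi^{(i)}\psi^{(j)}\chi^{(l)}(dx)^\mu$ with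 constants $\alpha_{i,j,l}\in\mathbb R$ and $\mu=\lambda+\gamma+\tau+k$. De Rham differential: $d:\mathcal F_0\to\mathcal F_1$, $d\varphi=\varphi'dx$. Poisson bracket: $\{\varphi(dx)^\lambda,\psi(dx)^\mu\}=(-\lambda\varphi\psi'+\mu\varphi'\psi)(dx)^{\lambda+\mu+1}$. Grozman operator: $\mathrm{Gz}:\mathcal F_{-2/3}\otimes\mathcal F_{-2/3}\to\mathcal F_{5/3}$, $\mathrm{Gz}(\varphi(dx)^{-2/3},\psi(dx)^{-2/3})=(2\varphi'''\psi+3\varphi''\psi'-3\varphi'\psi''-2\varphi\psi''')(dx)^{5/3}$. Dualizations: for $A=\sum\alpha_{i,j,l}\varphi^{(i)}\psi^{(j)}\chi^{(l)}$ from $\mathcal F_\lambda\otimes\mathcal F_\gamma\otimes\mathcal F_\tau$ to $\mathcal F_\mu$, the three dualizations are the formal adjoints (via integration by parts, $(\mathcal F_\alpha)^*:=\mathcal F_{1-\alpha}$) in each argument. $A^{*1}:\mathcal F_{1-\mu}\otimes\mathcal F_\gamma\otimes\mathcal F_\tau\to\mathcal F_{1-\lambda}$ is $(\omega,\psi,\chi)\mapsto\sum\alpha_{i,j,l}(-1)^i(\omega\psi^{(j)}\chi^{(l)})^{(i)}$; $A^{*2}:\mathcal F_\lambda\otimes\mathcal F_{1-\mu}\otimes\mathcal F_\tau\to\mathcal F_{1-\gamma}$ and $A^{*3}:\mathcal F_\lambda\otimes\mathcal F_\gamma\otimes\mathcal F_{1-\mu}\to\mathcal F_{1-\tau}$ are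 defined analogously. Permutations: for $\sigma\in S_3$, $A^\sigma(a,b,c)=A(\sigma^{-1}(a,b,c))$, with the weights permuted accordingly. "Up to permutations and dualizations" means after applying finitely many of these operations. The operator $\Delta_{\lambda,\gamma,\tau;3}:\mathcal F_\lambda\otimes\mathcal F_\gamma\otimes\mathcal F_\tau\to\mathcal F_{\lambda+\gamma+\tau+3}$ is $\sum_{i+j+l=3}\alpha_{i,j,l}\varphi^{(i)}\psi^{(j)}\chi^{(l)}(dx)^{\lambda+\gamma+\tau+3}$ with $\alpha_{3,0,0}=\gamma\tau(\tau-\gamma)(1+\gamma+\tau)$, $\alpha_{0,3,0}=\lambda\tau(\lambda-\tau)(1+\lambda+\tau)$, $\alpha_{0,0,3}=\gamma\lambda(\gamma-\lambda)(1+\gamma+\lambda)$, $\alpha_{1,1,1}=(\lambda-\gamma)(\gamma-\tau)(\lambda-\tau)$, $\alpha_{2,1,0}=\tau(1+\gamma+\tau)(2\lambda+\tau+\gamma(3\lambda+3\tau+4)+2)$, $\alpha_{1,2,0}=-\tau(1+\lambda+\tau)(2\gamma+\tau+\lambda(3\gamma+3\tau+4)+2)$, $\alpha_{2,0,1}=-\gamma(1+\gamma+\tau)(\gamma+2\lambda+(3\gamma+3\lambda+4)\tau+2)$, $\alpha_{1,0,2}=\gamma(1+\gamma+\lambda)(\gamma+2\tau+\lambda(3\gamma+3\tau+4)+2)$, $\alpha_{0,2,1}=\lambda(1+\lambda+\tau)(2\gamma+\lambda+(3\gamma+3\lambda+4)\tau+2)$, $\alpha_{0,1,2}=-\lambda(1+\gamma+\lambda)(\lambda+2\tau+\gamma(3\lambda+3\tau+4)+2)$.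 *)

theory Defs
  imports "HOL-Computational_Algebra.Polynomial" "HOL-Combinatorics.Permutations"
begin

section \<open>Weighted densities on the line\<close>

text \<open>
  \<open>Dens f w\<close> is the density $f (dx)^w$; the space of densities of weight \<open>w\<close> is
  \<open>{Dens f w | f. True}\<close>, identified with \<open>real poly\<close> once \<open>w\<close> is fixed.
\<close>

datatype density = Dens (coef: "real poly") (weight: real)

definition dens_mult :: "density \<Rightarrow> density \<Rightarrow> density"  (infixl "\<odot>" 70) where
  "a \<odot> b = Dens (coef a * coef b) (weight a + weight b)"

text \<open>Meant for arguments of weight 0 only.\<close>

definition deRham :: "density \<Rightarrow> density" where
  "deRham a = Dens (pderiv (coef a)) 1"

definition Poisson :: "density \<Rightarrow> density \<Rightarrow> density"  ("\<lbrace>_, _\<rbrace>") where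
  "\<lbrace>a, b\<rbrace> =
     Dens (smult (- weight a) (coef a * pderiv (coef b)) + smult (weight b) (pderiv (coef a) * coef b))
          (weight a + weight b + 1)"

text \<open>Meant for arguments of weight $-2/3$ only.\<close>

definition Grozman :: "density \<Rightarrow> density \<Rightarrow> density" where
  "Grozman a b =
     Dens (smult 2 ((pderiv ^^ 3) (coef a) * coef b)
         + smult 3 ((pderiv ^^ 2) (coef a) * pderiv (coef b))
         - smult 3 (pderiv (coef a) * (pderiv ^^ 2) (coef b))
         - smult 2 (coef a * (pderiv ^^ 3) (coef b))) (5/3)"

section \<open>Ternary differential operators and their invariance\<close>

type_synonym ternary_map = "real poly \<Rightarrow> real poly \<Rightarrow> real poly \<Rightarrow> real poly"

text \<open>
  The coefficients \<open>a i j l\<close> are polynomials, so that \<open>diff_op k a\<close> is a general ternary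
  differential operator of order at most \<open>k\<close>. Constancy of the coefficients and homogeneity
  (only $i + j + l = k$ occurs) are consequences of invariance and are not built in here.
\<close>

definition diff_op :: "nat \<Rightarrow> (nat \<Rightarrow> nat \<Rightarrow> nat \<Rightarrow> real poly) \<Rightarrow> ternary_map" where
  "diff_op k a \<phi> \<psi> \<chi> =
     (\<Sum>i\<le>k. \<Sum>j\<le>k - i. \<Sum>l\<le>k - i - j.
        a i j l * (pderiv ^^ i) \<phi> * (pderiv ^^ j) \<psi> * (pderiv ^^ l) \<chi>)"

definition is_diff_op :: "nat \<Rightarrow> ternary_map \<Rightarrow> bool" where
  "is_diff_op k A \<longleftrightarrow> (\<exists>a. A = diff_op k a)"

text \<open>Lie derivative of a density with coefficient \<open>f\<close> and weight \<open>w\<close> along $h\,d/dx$.\<close>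

definition Lie :: "real \<Rightarrow> real poly \<Rightarrow> real poly \<Rightarrow> real poly" where
  "Lie w h f = h * pderiv f + smult w (pderiv h * f)"

text \<open>\<open>(l, g, t, m, A)\<close> is the map \<open>A\<close> regarded as sending weights \<open>l\<close>, \<open>g\<close>, \<open>t\<close> to weight \<open>m\<close>.\<close>

type_synonym weighted_map = "real \<times> real \<times> real \<times> real \<times> ternary_map"

definition vect_invariant :: "weighted_map \<Rightarrow> bool" where
  "vect_invariant = (\<lambda>(l, g, t, m, A).
     \<forall>h \<phi> \<psi> \<chi>. Lie m h (A \<phi> \<psi> \<chi>) =
       A (Lie l h \<phi>) \<psi> \<chi> + A \<phi> (Lie g h \<psi>) \<chi> + A \<phi> \<psi> (Lie t h \<chi>))"

section \<open>Permutations and dualizations\<close>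

text \<open>Formal adjoints; for constant \<open>a i j l\<close> this factor can be pulled out of the derivative.\<close>

definition adjoint1 :: "nat \<Rightarrow> (nat \<Rightarrow> nat \<Rightarrow> nat \<Rightarrow> real poly) \<Rightarrow> ternary_map" where
  "adjoint1 k a \<omega> \<psi> \<chi> =
     (\<Sum>i\<le>k. \<Sum>j\<le>k - i. \<Sum>l\<le>k - i - j.
        (-1) ^ i * (pderiv ^^ i) (a i j l * \<omega> * (pderiv ^^ j) \<psi> * (pderiv ^^ l) \<chi>))"

definition adjoint2 :: "nat \<Rightarrow> (nat \<Rightarrow> nat \<Rightarrow> nat \<Rightarrow> real poly) \<Rightarrow> ternary_map" where
  "adjoint2 k a \<phi> \<omega> \<chi> =
     (\<Sum>i\<le>k. \<Sum>j\<le>k - i. \<Sum>l\<le>k - i - j.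
        (-1) ^ j * (pderiv ^^ j) (a i j l * (pderiv ^^ i) \<phi> * \<omega> * (pderiv ^^ l) \<chi>))"

definition adjoint3 :: "nat \<Rightarrow> (nat \<Rightarrow> nat \<Rightarrow> nat \<Rightarrow> real poly) \<Rightarrow> ternary_map" where
  "adjoint3 k a \<phi> \<psi> \<omega> =
     (\<Sum>i\<le>k. \<Sum>j\<le>k - i. \<Sum>l\<le>k - i - j.
        (-1) ^ l * (pderiv ^^ l) (a i j l * (pderiv ^^ i) \<phi> * (pderiv ^^ j) \<psi> * \<omega>))"

text \<open>
  One permutation or dualization. A map \<open>diff_op k a\<close> determines the coefficients \<open>a i j l\<close>
  with $i + j + l \le k$, so the adjoints depend only on the operator. In \<open>perm\<close>, arguments are
  numbered 0, 1, 2; since $\sigma^{-1}$ moves the entry in place $\sigma(p)$ to place $p$,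
  $A^\sigma$ feeds its argument number $\sigma(p)$ into place $p$ of $A$, and the weights of $A$
  are those of $A^\sigma$ rearranged in the same way.
\<close>

inductive perm_dual_step :: "weighted_map \<Rightarrow> weighted_map \<Rightarrow> bool" where
  perm: "\<sigma> permutes {0, 1, 2::nat} \<Longrightarrow> w = [l, g, t] \<Longrightarrow>
    perm_dual_step
      (w ! \<sigma> 0, w ! \<sigma> 1, w ! \<sigma> 2, m, A)
      (l, g, t, m, \<lambda>\<phi> \<psi> \<chi>. A ([\<phi>, \<psi>, \<chi>] ! \<sigma> 0) ([\<phi>, \<psi>, \<chi>] ! \<sigma> 1) ([\<phi>, \<psi>, \<chi>] ! \<sigma> 2))"
| dual1: "perm_dual_step (l, g, t, m, diff_op k a) (1 - m, g, t, 1 - l, adjoint1 k a)"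
| dual2: "perm_dual_step (l, g, t, m, diff_op k a) (l, 1 - m, t, 1 - g, adjoint2 k a)"
| dual3: "perm_dual_step (l, g, t, m, diff_op k a) (l, g, 1 - m, 1 - t, adjoint3 k a)"

abbreviation perm_dual :: "weighted_map \<Rightarrow> weighted_map \<Rightarrow> bool" where
  "perm_dual \<equiv> perm_dual_step\<^sup>*\<^sup>*"

section \<open>The generic operator and the exceptional weights\<close>

definition Delta3 :: "real \<Rightarrow> real \<Rightarrow> real \<Rightarrow> ternary_map" where
  "Delta3 l g t \<phi> \<psi> \<chi> =
     smult (g * t * (t - g) * (1 + g + t)) ((pderiv ^^ 3) \<phi> * \<psi> * \<chi>)
   + smult (l * t * (l - t) * (1 + l + t)) (\<phi> * (pderiv ^^ 3) \<psi> * \<chi>)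
   + smult (g * l * (g - l) * (1 + g + l)) (\<phi> * \<psi> * (pderiv ^^ 3) \<chi>)
   + smult ((l - g) * (g - t) * (l - t)) (pderiv \<phi> * pderiv \<psi> * pderiv \<chi>)
   + smult (t * (1 + g + t) * (2 * l + t + g * (3 * l + 3 * t + 4) + 2))
       ((pderiv ^^ 2) \<phi> * pderiv \<psi> * \<chi>)
   + smult (- t * (1 + l + t) * (2 * g + t + l * (3 * g + 3 * t + 4) + 2))
       (pderiv \<phi> * (pderiv ^^ 2) \<psi> * \<chi>)
   + smult (- g * (1 + g + t) * (g + 2 * l + (3 * g + 3 * l + 4) * t + 2))
       ((pderiv ^^ 2) \<phi> * \<psi> * pderiv \<chi>)
   + smult (g * (1 + g + l) * (g + 2 * t + l * (3 * g + 3 * t + 4) + 2))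
       (pderiv \<phi> * \<psi> * (pderiv ^^ 2) \<chi>)
   + smult (l * (1 + l + t) * (2 * g + l + (3 * g + 3 * l + 4) * t + 2))
       (\<phi> * (pderiv ^^ 2) \<psi> * pderiv \<chi>)
   + smult (- l * (1 + g + l) * (l + 2 * t + g * (3 * l + 3 * t + 4) + 2))
       (\<phi> * pderiv \<psi> * (pderiv ^^ 2) \<chi>)"

definition exceptional :: "real \<Rightarrow> real \<Rightarrow> real \<Rightarrow> bool" where
  "exceptional l g t \<longleftrightarrow>
     (g, l, t) = (0, 0, 0) \<or>
     (l = 0 \<and> g\<^sup>2 + t\<^sup>2 \<noteq> 0) \<or>
     (g, l, t) = (-2/3, -2/3, -2/3) \<or>
     (g, l, t) = (-1/2, -1/2, -1/2) \<or>
     (1 + l + t = 0 \<and> g = l \<and> l \<noteq> t)"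

end

theory Submission
  imports Defs
begin

text \<open>
  An operator from $\mathcal F_\lambda \otimes \mathcal F_\gamma \otimes \mathcal F_\tau$ to $\mathcal F_\mu$
  amounts to an invariant form in four arguments, the fourth of weight $\nu = 1 - \mu = -2 - \lambda - \gamma
  - \tau$. Dualization and permutation of arguments permute the four weights, and every permutation of them
  arises. So one may choose the order of the four weights, and the classification
  depends on them only as a multiset.

  Evaluating invariance on powers of \<open>x - c\<close> along the fields \<open>1\<close>, \<open>x - c\<close>, $x^2$, $x^3$ shows that the
  coefficients are constants $\alpha_{i,j,l}$ with $i + j + l = 3$ satisfying nine linear equations in ten
  unknowns (\<open>invariant_imp_hom_op\<close>). What remains is linear algebra with parameters.

  For nonzero weights, rescaling reduces the nine equations to two linear relations between three quantities
  (\<open>reduced_system\<close>). The cross product of the two relations is $12 \nu$ times the vector given by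
  $\Delta_{\lambda,\gamma,\tau;3}$. Hence, if $\nu \neq 0$ and $\Delta_{\lambda,\gamma,\tau;3} \neq 0$, every
  solution is a multiple of it (\<open>generic_solution\<close>); and for nonzero weights it vanishes only if the
  four weights are $a, a, -1-a, -1-a$ for some $a$ (\<open>Delta3_coeffs_zero\<close>).

  The remaining weights are those where some weight is 0 or where they form two such pairs. They are
  exactly the weights that can be rearranged into one of the exceptional cases. There the rearrangement is
  chosen so that the listed operators span all solutions, and the parameters $\epsilon_i$ are read off from
  a few coefficients. This choice matters when a weight is 0. The weights $0, 0, 0, -2$ must be arranged as
  $(0, 0, 0)$, because at $(0, 0, -2)$ the second operator of the family
  with $\lambda = 0$ vanishes. The weights $0, -2/3, -2/3, -2/3$ must be arranged with 0 in the
  fourth place, because with $\lambda = 0$ there is one more operator, $\varphi \, \mathrm{Gz}(\psi, \chi)$.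
\<close>

section \<open>Coefficients of an invariant operator\<close>

text \<open>
  Powers of \<open>x - c\<close> pick out single derivatives at \<open>c\<close>; this is what turns identities between
  operators into identities between their coefficients.
\<close>

lemma poly_higher_pderiv_shifted_power:
  "poly ((pderiv ^^ n) ([:-c, 1:] ^ m)) c = (if n = m then fact m else (0::real))"
proof (induction n arbitrary: m)
  case 0
  then show ?case by (cases m) auto
next
  case (Suc n)
  show ?case
  proof (cases m)
    case 0
    then show ?thesis by (simp add: funpow_Suc_right del: funpow.simps)
  next
    case (Suc m')
    have "pderiv ([:-c, 1:] ^ Suc m') = smult (real (Suc m')) ([:-c, 1:] ^ m')"
      by (simp only: pderiv_power_Suc) (simp add: pderiv_pCons)
    then have "(pderiv ^^ Suc n) ([:-c, 1:] ^ m) = smult (real (Suc m')) ((pderiv ^^ n) ([:-c, 1:] ^ m'))"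
      by (simp only: Suc funpow_Suc_right o_apply higher_pderiv_smult)
    then show ?thesis using Suc by (simp add: Suc.IH)
  qed
qed

lemma diff_op_shifted_powers:
  "poly (diff_op k a ([:-c, 1:] ^ i) ([:-c, 1:] ^ j) ([:-c, 1:] ^ l)) c
    = (if i + j + l \<le> k then fact i * fact j * fact l * poly (a i j l) c else 0)"
proof -
  have "poly (diff_op k a ([:-c, 1:] ^ i) ([:-c, 1:] ^ j) ([:-c, 1:] ^ l)) c
    = (\<Sum>i'\<le>k. \<Sum>j'\<le>k - i'. \<Sum>l'\<le>k - i' - j'.
        if l' = l then (if j' = j then if i' = i then fact i * fact j * fact l * poly (a i j l) c else 0 else 0) else 0)"
    unfolding diff_op_def poly_sum
    by (intro sum.cong refl) (simp add: poly_higher_pderiv_shifted_power)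
  also have "\<dots> = (\<Sum>i'\<le>k. \<Sum>j'\<le>k - i'. if j' = j then
        if i' = i \<and> l \<le> k - i' - j then fact i * fact j * fact l * poly (a i j l) c else 0 else 0)"
    by (intro sum.cong refl) auto
  also have "\<dots> = (\<Sum>i'\<le>k. if i' = i then
        if j \<le> k - i \<and> l \<le> k - i - j then fact i * fact j * fact l * poly (a i j l) c else 0 else 0)"
    by (intro sum.cong refl) auto
  also have "\<dots> = (if i + j + l \<le> k then fact i * fact j * fact l * poly (a i j l) c else 0)"
    by auto
  finally show ?thesis .
qed

text \<open>
  The field $(x-c)^{r+1} d/dx$ raises the exponent by \<open>r\<close>, so invariance under it relates the values
  of an operator on shifted powers only to other such values.
\<close>

lemma Lie_shifted_power:
  "Lie w ([:-c, 1:] ^ Suc r) ([:-c, 1:] ^ i)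
    = smult (real i + real (Suc r) * w) ([:-c, 1:] ^ (i + r))"
proof -
  have d: "[:-c, 1:] * pderiv ([:-c, 1:] ^ n) = smult (real n) ([:-c, 1:] ^ n)" for n
  proof (cases n)
    case (Suc n')
    have "pderiv ([:-c, 1:] ^ Suc n') = smult (real (Suc n')) ([:-c, 1:] ^ n')"
      by (simp only: pderiv_power_Suc) (simp add: pderiv_pCons)
    then show ?thesis by (simp only: Suc mult_smult_right power_Suc)
  qed simp
  have d': "pderiv ([:-c, 1:] ^ Suc r) = smult (real (Suc r)) ([:-c, 1:] ^ r)"
      by (simp only: pderiv_power_Suc) (simp add: pderiv_pCons)
  have "[:-c, 1:] ^ Suc r * pderiv ([:-c, 1:] ^ i) = [:-c, 1:] ^ r * ([:-c, 1:] * pderiv ([:-c, 1:] ^ i))"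
    by (simp only: power_Suc2 mult.assoc)
  also have "\<dots> = smult (real i) ([:-c, 1:] ^ (i + r))"
    by (simp only: d mult_smult_right power_add mult.commute)
  finally have *: "[:-c, 1:] ^ Suc r * pderiv ([:-c, 1:] ^ i) = smult (real i) ([:-c, 1:] ^ (i + r))" .
  show ?thesis
    unfolding Lie_def * d'
    by (simp only: power_add mult_smult_left mult_smult_right smult_smult smult_add_left mult.commute)
qed

lemma diff_op_smult:
  "diff_op k a (smult s \<phi>) \<psi> \<chi> = smult s (diff_op k a \<phi> \<psi> \<chi>)"
  "diff_op k a \<phi> (smult s \<psi>) \<chi> = smult s (diff_op k a \<phi> \<psi> \<chi>)"
  "diff_op k a \<phi> \<psi> (smult s \<chi>) = smult s (diff_op k a \<phi> \<psi> \<chi>)"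
proof -
  have "smult s (sum f I) = (\<Sum>x\<in>I. smult s (f x))" for f :: "nat \<Rightarrow> real poly" and I
    by (induction I rule: infinite_finite_induct) (simp_all add: smult_add_right)
  then show "diff_op k a (smult s \<phi>) \<psi> \<chi> = smult s (diff_op k a \<phi> \<psi> \<chi>)"
    "diff_op k a \<phi> (smult s \<psi>) \<chi> = smult s (diff_op k a \<phi> \<psi> \<chi>)"
    "diff_op k a \<phi> \<psi> (smult s \<chi>) = smult s (diff_op k a \<phi> \<psi> \<chi>)"
    by (simp_all add: diff_op_def higher_pderiv_smult)
qed

lemma pderiv_diff_op:
  "pderiv (diff_op k a \<phi> \<psi> \<chi>) =
     diff_op k (\<lambda>i j l. pderiv (a i j l)) \<phi> \<psi> \<chi>
   + diff_op k a (pderiv \<phi>) \<psi> \<chi> + diff_op k a \<phi> (pderiv \<psi>) \<chi> + diff_op k a \<phi> \<psi> (pderiv \<chi>)"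
  unfolding diff_op_def higher_pderiv_sum[of 1, simplified] sum.distrib[symmetric]
  by (intro sum.cong refl)
     (simp add: pderiv_mult funpow_swap1[symmetric] algebra_simps del: pderiv.simps)

text \<open>
  Here \<open>P i j n\<close> is the value at \<open>c\<close> of the operator on $(x-c)^i, (x-c)^j, (x-c)^n$. On the left,
  the Lie derivative along $(x-c)^{r+1} d/dx$ is evaluated at \<open>c\<close>: the field vanishes there, and its
  first derivative is 1 for \<open>r = 0\<close> and 0 otherwise.
\<close>

lemma invariance_on_shifted_powers:
  fixes c :: real
  assumes "vect_invariant (l, g, t, m, diff_op k a)"
  defines "P \<equiv> \<lambda>i j n. if i + j + n \<le> k then fact i * fact j * fact n * poly (a i j n) c else 0"
  shows "(if r = 0 then m else 0) * P i j n =
     (real i + real (Suc r) * l) * P (i + r) j n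
   + (real j + real (Suc r) * g) * P i (j + r) n
   + (real n + real (Suc r) * t) * P i j (n + r)"
proof -
  let ?e = "\<lambda>i. [:-c, 1:] ^ i"
  have P: "P i j n = poly (diff_op k a (?e i) (?e j) (?e n)) c" for i j n
    by (simp only: P_def diff_op_shifted_powers)
  have d: "pderiv (?e (Suc r)) = smult (real (Suc r)) (?e r)"
    by (simp only: pderiv_power_Suc) (simp add: pderiv_pCons)
  have "poly (Lie m (?e (Suc r)) F) c = (if r = 0 then m else 0) * poly F c" for F
    unfolding Lie_def d by (cases r) auto
  then have "(if r = 0 then m else 0) * P i j n
      = poly (Lie m (?e (Suc r)) (diff_op k a (?e i) (?e j) (?e n))) c"
    by (simp only: P)
  also have "\<dots> = poly (diff_op k a (Lie l (?e (Suc r)) (?e i)) (?e j) (?e n)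
      + diff_op k a (?e i) (Lie g (?e (Suc r)) (?e j)) (?e n)
      + diff_op k a (?e i) (?e j) (Lie t (?e (Suc r)) (?e n))) c"
    using assms(1) by (simp add: vect_invariant_def del: power_Suc)
  also have "\<dots> = (real i + real (Suc r) * l) * P (i + r) j n
   + (real j + real (Suc r) * g) * P i (j + r) n
   + (real n + real (Suc r) * t) * P i j (n + r)"
    unfolding Lie_shifted_power diff_op_smult P by (simp only: poly_add poly_smult)
  finally show ?thesis .
qed

lemma diff_op_cong:
  assumes "\<And>i j l. i + j + l \<le> k \<Longrightarrow> a i j l = b i j l"
  shows "diff_op k a = diff_op k b"
  unfolding diff_op_def fun_eq_iff by (auto intro!: sum.cong simp: assms)

definition hom_op :: "(nat \<Rightarrow> nat \<Rightarrow> nat \<Rightarrow> real) \<Rightarrow> ternary_map" where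
  "hom_op \<alpha> = diff_op 3 (\<lambda>i j n. if i + j + n = 3 then [:\<alpha> i j n:] else 0)"

text \<open>
  The first six equations express invariance under $x^2 d/dx$, tested on monomials of total degree 2,
  and the last three invariance under $x^3 d/dx$, tested on monomials of total degree 1; common numerical
  factors are cancelled. The fields $x^k d/dx$ with $k \ge 4$ are iterated brackets of these two.
\<close>

definition coeff_system :: "real \<Rightarrow> real \<Rightarrow> real \<Rightarrow> (nat \<Rightarrow> nat \<Rightarrow> nat \<Rightarrow> real) \<Rightarrow> bool" where
  "coeff_system l g t \<alpha> \<longleftrightarrow>
     3 * (1 + l) * \<alpha> 3 0 0 + g * \<alpha> 2 1 0 + t * \<alpha> 2 0 1 = 0 \<and>
     l * \<alpha> 1 2 0 + 3 * (1 + g) * \<alpha> 0 3 0 + t * \<alpha> 0 2 1 = 0 \<and>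
     l * \<alpha> 1 0 2 + g * \<alpha> 0 1 2 + 3 * (1 + t) * \<alpha> 0 0 3 = 0 \<and>
     (1 + 2 * l) * \<alpha> 2 1 0 + (1 + 2 * g) * \<alpha> 1 2 0 + t * \<alpha> 1 1 1 = 0 \<and>
     (1 + 2 * l) * \<alpha> 2 0 1 + g * \<alpha> 1 1 1 + (1 + 2 * t) * \<alpha> 1 0 2 = 0 \<and>
     l * \<alpha> 1 1 1 + (1 + 2 * g) * \<alpha> 0 2 1 + (1 + 2 * t) * \<alpha> 0 1 2 = 0 \<and>
     (1 + 3 * l) * \<alpha> 3 0 0 + g * \<alpha> 1 2 0 + t * \<alpha> 1 0 2 = 0 \<and>
     l * \<alpha> 2 1 0 + (1 + 3 * g) * \<alpha> 0 3 0 + t * \<alpha> 0 1 2 = 0 \<and>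
     l * \<alpha> 2 0 1 + g * \<alpha> 0 2 1 + (1 + 3 * t) * \<alpha> 0 0 3 = 0"

text \<open>
  The field $(x-c) d/dx$ measures the order of each term and leaves only order 3; the field $d/dx$
  forces the coefficients to be constant.
\<close>

lemma invariant_imp_hom_op:
  assumes A: "is_diff_op 3 A" and inv: "vect_invariant (l, g, t, l + g + t + 3, A)"
  obtains \<alpha> where "A = hom_op \<alpha>" and "coeff_system l g t \<alpha>"
proof -
  obtain a where a: "A = diff_op 3 a" using A by (auto simp: is_diff_op_def)
  note inv' = invariance_on_shifted_powers[OF inv[unfolded a]]
  \<comment> \<open>homogeneity, from the field \<open>x - c\<close>\<close>
  have hom: "a i j n = 0" if "i + j + n \<le> 3" "i + j + n \<noteq> 3" for i j n
  proof -
    have "poly (a i j n) c = 0" for c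
    proof -
      have *: "real (i + j + n) \<noteq> real 3" using that(2) by linarith
      have "fact i * fact j * fact n * ((real (i + j + n) - 3) * poly (a i j n) c) = 0"
        using inv'[where r = 0 and c = c and i = i and j = j and n = n] that(1)
        by (simp add: algebra_simps)
      then show ?thesis using * by simp
    qed
    then show ?thesis using poly_all_0_iff_0 by blast
  qed
  \<comment> \<open>constancy, from the field \<open>1\<close>\<close>
  have const: "pderiv (a i j n) = 0" if "i + j + n = 3" for i j n
  proof -
    have "Lie w 1 f = pderiv f" for w f by (simp add: Lie_def)
    then have "diff_op 3 (\<lambda>i j l. pderiv (a i j l)) \<phi> \<psi> \<chi> = 0" for \<phi> \<psi> \<chi>
      using inv[unfolded a vect_invariant_def, simplified, rule_format, of 1 \<phi> \<psi> \<chi>]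
      by (simp add: pderiv_diff_op)
    then have "poly (pderiv (a i j n)) c = 0" for c
      using diff_op_shifted_powers[of 3 "\<lambda>i j l. pderiv (a i j l)" c i j n] that
      by simp
    then show ?thesis using poly_all_0_iff_0 by blast
  qed
  define \<alpha> where "\<alpha> i j n = poly (a i j n) 0" for i j n
  have a\<alpha>: "a i j n = [:\<alpha> i j n:]" if "i + j + n = 3" for i j n
  proof -
    have "degree (a i j n) = 0" using const[OF that] by (simp add: pderiv_eq_0_iff)
    then show ?thesis by (elim degree_eq_zeroE) (simp add: \<alpha>_def)
  qed
  have "A = hom_op \<alpha>"
    unfolding a hom_op_def by (rule diff_op_cong) (auto simp: a\<alpha> hom)
  have sys2: "(real i + 2 * l) * (real i + 1) * \<alpha> (i + 1) j n
     + (real j + 2 * g) * (real j + 1) * \<alpha> i (j + 1) n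
     + (real n + 2 * t) * (real n + 1) * \<alpha> i j (n + 1) = 0"
    if "i + j + n = 2" for i j n
  proof -
    have "fact i * fact j * fact n *
     ((real i + 2 * l) * (real i + 1) * \<alpha> (i + 1) j n
     + (real j + 2 * g) * (real j + 1) * \<alpha> i (j + 1) n
     + (real n + 2 * t) * (real n + 1) * \<alpha> i j (n + 1)) = 0"
      using inv'[where r = 1 and c = 0 and i = i and j = j and n = n] that
      by (simp add: algebra_simps flip: \<alpha>_def)
    then show ?thesis by simp
  qed
  have sys3: "(real i + 3 * l) * (real i + 1) * (real i + 2) * \<alpha> (i + 2) j n
     + (real j + 3 * g) * (real j + 1) * (real j + 2) * \<alpha> i (j + 2) n
     + (real n + 3 * t) * (real n + 1) * (real n + 2) * \<alpha> i j (n + 2) = 0"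
    if "i + j + n = 1" for i j n
  proof -
    have "fact i * fact j * fact n *
     ((real i + 3 * l) * (real i + 1) * (real i + 2) * \<alpha> (i + 2) j n
     + (real j + 3 * g) * (real j + 1) * (real j + 2) * \<alpha> i (j + 2) n
     + (real n + 3 * t) * (real n + 1) * (real n + 2) * \<alpha> i j (n + 2)) = 0"
      using inv'[where r = 2 and c = 0 and i = i and j = j and n = n] that
      by (simp add: algebra_simps flip: \<alpha>_def)
    then show ?thesis by simp
  qed
  have "coeff_system l g t \<alpha>"
    unfolding coeff_system_def
  proof (intro conjI)
    show "3 * (1 + l) * \<alpha> 3 0 0 + g * \<alpha> 2 1 0 + t * \<alpha> 2 0 1 = 0"
      using sys2[of 2 0 0] by (simp add: numeral_eq_Suc algebra_simps)
    show "l * \<alpha> 1 2 0 + 3 * (1 + g) * \<alpha> 0 3 0 + t * \<alpha> 0 2 1 = 0"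
      using sys2[of 0 2 0] by (simp add: numeral_eq_Suc algebra_simps)
    show "l * \<alpha> 1 0 2 + g * \<alpha> 0 1 2 + 3 * (1 + t) * \<alpha> 0 0 3 = 0"
      using sys2[of 0 0 2] by (simp add: numeral_eq_Suc algebra_simps)
    show "(1 + 2 * l) * \<alpha> 2 1 0 + (1 + 2 * g) * \<alpha> 1 2 0 + t * \<alpha> 1 1 1 = 0"
      using sys2[of 1 1 0] by (simp add: numeral_eq_Suc algebra_simps)
    show "(1 + 2 * l) * \<alpha> 2 0 1 + g * \<alpha> 1 1 1 + (1 + 2 * t) * \<alpha> 1 0 2 = 0"
      using sys2[of 1 0 1] by (simp add: numeral_eq_Suc algebra_simps)
    show "l * \<alpha> 1 1 1 + (1 + 2 * g) * \<alpha> 0 2 1 + (1 + 2 * t) * \<alpha> 0 1 2 = 0"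
      using sys2[of 0 1 1] by (simp add: numeral_eq_Suc algebra_simps)
    show "(1 + 3 * l) * \<alpha> 3 0 0 + g * \<alpha> 1 2 0 + t * \<alpha> 1 0 2 = 0"
      using sys3[of 1 0 0] by (simp add: numeral_eq_Suc algebra_simps)
    show "l * \<alpha> 2 1 0 + (1 + 3 * g) * \<alpha> 0 3 0 + t * \<alpha> 0 1 2 = 0"
      using sys3[of 0 1 0] by (simp add: numeral_eq_Suc algebra_simps)
    show "l * \<alpha> 2 0 1 + g * \<alpha> 0 2 1 + (1 + 3 * t) * \<alpha> 0 0 3 = 0"
      using sys3[of 0 0 1] by (simp add: numeral_eq_Suc algebra_simps)
  qed
  with \<open>A = hom_op \<alpha>\<close> show thesis by (rule that)
qed

lemma real_poly_eqI: "(\<And>x. poly p x = poly q x) \<Longrightarrow> p = (q :: real poly)"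
  using poly_eq_poly_eq_iff by blast

lemma poly_hom_op:
  "poly (hom_op \<alpha> \<phi> \<psi> \<chi>) x =
     \<alpha> 3 0 0 * (poly ((pderiv ^^ 3) \<phi>) x * poly \<psi> x * poly \<chi> x)
   + \<alpha> 0 3 0 * (poly \<phi> x * poly ((pderiv ^^ 3) \<psi>) x * poly \<chi> x)
   + \<alpha> 0 0 3 * (poly \<phi> x * poly \<psi> x * poly ((pderiv ^^ 3) \<chi>) x)
   + \<alpha> 1 1 1 * (poly (pderiv \<phi>) x * poly (pderiv \<psi>) x * poly (pderiv \<chi>) x)
   + \<alpha> 2 1 0 * (poly ((pderiv ^^ 2) \<phi>) x * poly (pderiv \<psi>) x * poly \<chi> x)
   + \<alpha> 1 2 0 * (poly (pderiv \<phi>) x * poly ((pderiv ^^ 2) \<psi>) x * poly \<chi> x)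
   + \<alpha> 2 0 1 * (poly ((pderiv ^^ 2) \<phi>) x * poly \<psi> x * poly (pderiv \<chi>) x)
   + \<alpha> 1 0 2 * (poly (pderiv \<phi>) x * poly \<psi> x * poly ((pderiv ^^ 2) \<chi>) x)
   + \<alpha> 0 2 1 * (poly \<phi> x * poly ((pderiv ^^ 2) \<psi>) x * poly (pderiv \<chi>) x)
   + \<alpha> 0 1 2 * (poly \<phi> x * poly (pderiv \<psi>) x * poly ((pderiv ^^ 2) \<chi>) x)"
  by (simp add: hom_op_def diff_op_def numeral_eq_Suc)

lemma degree_3_cases:
  fixes i j n :: nat
  assumes "i + j + n = 3"
  shows "(i, j, n) \<in> {(3,0,0), (0,3,0), (0,0,3), (1,1,1), (2,1,0), (1,2,0), (2,0,1), (1,0,2), (0,2,1), (0,1,2)}"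
proof -
  have "i \<in> {0, 1, 2, 3}" "j \<in> {0, 1, 2, 3}" and n: "n = 3 - i - j" using assms by auto
  then show ?thesis using assms unfolding n by (elim insertE emptyE; simp)
qed

section \<open>Permutations and dualizations as permutations of four weights\<close>

text \<open>
  Some operator reachable from \<open>X\<close> has the weights \<open>l\<close>, \<open>g\<close>, \<open>t\<close> and is again invariant, invariance being
  recorded as the coefficient system so that it can be followed through each move by linear algebra.
\<close>

definition realizes :: "weighted_map \<Rightarrow> real \<Rightarrow> real \<Rightarrow> real \<Rightarrow> bool" where
  "realizes X l g t \<longleftrightarrow>
     (\<exists>\<alpha>. perm_dual X (l, g, t, l + g + t + 3, hom_op \<alpha>) \<and> coeff_system l g t \<alpha>)"

lemma realizes_step:
  assumes "perm_dual X Y" and "perm_dual_step Y (l, g, t, m, B)"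
    and "B = hom_op \<beta>" and "coeff_system l g t \<beta>" and "m = l + g + t + 3"
  shows "realizes X l g t"
  unfolding realizes_def using assms by (auto intro: rtranclp.rtrancl_into_rtrancl)

lemma realizes_swap12:
  assumes "realizes X l g t"
  shows "realizes X g l t"
proof -
  obtain \<alpha> where r: "perm_dual X (l, g, t, l + g + t + 3, hom_op \<alpha>)" and s: "coeff_system l g t \<alpha>"
    using assms by (auto simp: realizes_def)
  let ?\<beta> = "\<lambda>i j n. \<alpha> j i n"
  have op: "(\<lambda>\<phi> \<psi> \<chi>. hom_op \<alpha> \<psi> \<phi> \<chi>) = hom_op ?\<beta>"
    by (intro ext real_poly_eqI) (simp add: poly_hom_op algebra_simps)
  have step: "perm_dual_step (l, g, t, l + g + t + 3, hom_op \<alpha>)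
     (g, l, t, l + g + t + 3, \<lambda>\<phi> \<psi> \<chi>. hom_op \<alpha> \<psi> \<phi> \<chi>)"
    using perm[OF permutes_swap_id[of 0 _ 1] refl, of g l t "l + g + t + 3" "hom_op \<alpha>"]
    by (simp add: transpose_def)
  have sys: "coeff_system g l t ?\<beta>"
    using s unfolding coeff_system_def by (simp add: ac_simps)
  show ?thesis
    by (rule realizes_step[OF r step op sys]) simp
qed

lemma realizes_swap23:
  assumes "realizes X l g t"
  shows "realizes X l t g"
proof -
  obtain \<alpha> where r: "perm_dual X (l, g, t, l + g + t + 3, hom_op \<alpha>)" and s: "coeff_system l g t \<alpha>"
    using assms by (auto simp: realizes_def)
  let ?\<beta> = "\<lambda>i j n. \<alpha> i n j"
  have op: "(\<lambda>\<phi> \<psi> \<chi>. hom_op \<alpha> \<phi> \<chi> \<psi>) = hom_op ?\<beta>"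
    by (intro ext real_poly_eqI) (simp add: poly_hom_op algebra_simps)
  have step: "perm_dual_step (l, g, t, l + g + t + 3, hom_op \<alpha>)
     (l, t, g, l + g + t + 3, \<lambda>\<phi> \<psi> \<chi>. hom_op \<alpha> \<phi> \<chi> \<psi>)"
    using perm[OF permutes_swap_id[of 1 _ 2] refl, of l t g "l + g + t + 3" "hom_op \<alpha>"]
    by (simp add: transpose_def)
  have sys: "coeff_system l t g ?\<beta>"
    using s unfolding coeff_system_def by (simp add: ac_simps)
  show ?thesis
    by (rule realizes_step[OF r step op sys]) simp
qed

text \<open>
  Leibniz' rule for $(-1)^m (\omega \psi^{(b)} \chi^{(c)})^{(m)}$: of the \<open>m = i + q + r\<close> derivatives,
  \<open>i\<close> fall on the first factor, \<open>q\<close> on the second and \<open>r\<close> on the third.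
\<close>

definition adjoint_coeffs :: "(nat \<Rightarrow> nat \<Rightarrow> nat \<Rightarrow> real) \<Rightarrow> nat \<Rightarrow> nat \<Rightarrow> nat \<Rightarrow> real" where
  "adjoint_coeffs \<alpha> i j n = (\<Sum>q\<le>j. \<Sum>r\<le>n.
     (-1) ^ (i + q + r) * fact (i + q + r) / (fact i * fact q * fact r) * \<alpha> (i + q + r) (j - q) (n - r))"

lemma adjoint_coeffs_simps:
  "adjoint_coeffs \<alpha> 3 0 0 = - \<alpha> 3 0 0"
  "adjoint_coeffs \<alpha> 0 3 0 = \<alpha> 0 3 0 - \<alpha> 1 2 0 + \<alpha> 2 1 0 - \<alpha> 3 0 0"
  "adjoint_coeffs \<alpha> 0 0 3 = \<alpha> 0 0 3 - \<alpha> 1 0 2 + \<alpha> 2 0 1 - \<alpha> 3 0 0"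
  "adjoint_coeffs \<alpha> 1 1 1 = - \<alpha> 1 1 1 + 2 * \<alpha> 2 1 0 + 2 * \<alpha> 2 0 1 - 6 * \<alpha> 3 0 0"
  "adjoint_coeffs \<alpha> 2 1 0 = \<alpha> 2 1 0 - 3 * \<alpha> 3 0 0"
  "adjoint_coeffs \<alpha> 1 2 0 = - \<alpha> 1 2 0 + 2 * \<alpha> 2 1 0 - 3 * \<alpha> 3 0 0"
  "adjoint_coeffs \<alpha> 2 0 1 = \<alpha> 2 0 1 - 3 * \<alpha> 3 0 0"
  "adjoint_coeffs \<alpha> 1 0 2 = - \<alpha> 1 0 2 + 2 * \<alpha> 2 0 1 - 3 * \<alpha> 3 0 0"
  "adjoint_coeffs \<alpha> 0 2 1 = \<alpha> 0 2 1 - \<alpha> 1 1 1 - \<alpha> 1 2 0 + \<alpha> 2 0 1 + 2 * \<alpha> 2 1 0 - 3 * \<alpha> 3 0 0"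
  "adjoint_coeffs \<alpha> 0 1 2 = \<alpha> 0 1 2 - \<alpha> 1 1 1 - \<alpha> 1 0 2 + \<alpha> 2 1 0 + 2 * \<alpha> 2 0 1 - 3 * \<alpha> 3 0 0"
  by (simp_all add: adjoint_coeffs_def numeral_eq_Suc)

text \<open>
  Each equation of the system for the adjoint is a combination, with integer coefficients, of equations of
  the original system.
\<close>

lemma realizes_dual1:
  assumes "realizes X l g t"
  shows "realizes X (- 2 - l - g - t) g t"
proof -
  obtain \<alpha> where r: "perm_dual X (l, g, t, l + g + t + 3, hom_op \<alpha>)" and s: "coeff_system l g t \<alpha>"
    using assms by (auto simp: realizes_def)
  have weight: "- 2 - l - g - t = 1 - (l + g + t + 3)" by simp
  let ?a = "\<lambda>i j n. if i + j + n = 3 then [:\<alpha> i j n:] else 0"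
  have op: "adjoint1 3 ?a = hom_op (adjoint_coeffs \<alpha>)"
    by (intro ext real_poly_eqI)
      (simp only: poly_hom_op adjoint1_def adjoint_coeffs_simps, 
       simp add: numeral_eq_Suc pderiv_mult pderiv_add pderiv_smult, simp add: algebra_simps)
  have step: "perm_dual_step (l, g, t, l + g + t + 3, hom_op \<alpha>)
     (- 2 - l - g - t, g, t, 1 - l, adjoint1 3 ?a)"
    unfolding hom_op_def weight by (rule dual1)
  have sys: "coeff_system (- 2 - l - g - t) g t (adjoint_coeffs \<alpha>)"
    unfolding coeff_system_def adjoint_coeffs_simps
    using s[unfolded coeff_system_def]
    by (elim conjE, intro conjI; algebra)
  show ?thesis
    by (rule realizes_step[OF r step op sys]) simp
qed

text \<open>
  The two transpositions of arguments and the first dualization generate all permutations of the four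
  weights. The proof moves \<open>l'\<close> to the first place, then \<open>g'\<close> to the second and \<open>t'\<close> to the third.
\<close>

lemma realizes_rearranged:
  assumes X: "realizes X l g t"
    and eq: "{#l', g', t', - 2 - l' - g' - t'#} = {#l, g, t, - 2 - l - g - t#}"
  shows "realizes X l' g' t'"
proof -
  obtain p q where 1: "realizes X l' p q" 
    and eq1: "{#l', g', t', - 2 - l' - g' - t'#} = {#l', p, q, - 2 - l' - p - q#}"
  proof -
    have "l' \<in># {#l, g, t, - 2 - l - g - t#}" by (simp flip: eq)
    then consider "l' = l" | "l' = g" | "l' = t" | "l' = - 2 - l - g - t" by auto
    then show thesis
    proof cases
      case 1 then show thesis using that[of g t] X eq by simp
    next
      case 2 then show thesis using that[of l t] realizes_swap12[OF X] eq 
        by (simp add: add_mset_commute algebra_simps)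
    next
      case 3 then show thesis using that[of l g] realizes_swap12[OF realizes_swap23[OF X]] eq
        by (simp add: add_mset_commute algebra_simps)
    next
      case 4
      then have l: "l = - 2 - l' - g - t" by simp
      have "realizes X l' g t" using realizes_dual1[OF X] 4 by simp
      moreover have "{#l', g, t, - 2 - l' - g - t#} = {#l, g, t, - 2 - l - g - t#}"
        unfolding 4[symmetric] l[symmetric] by (simp add: add_mset_commute)
      ultimately show thesis using that[of g t] eq by simp
    qed
  qed
  obtain s where 2: "realizes X l' g' s" 
    and eq2: "{#t', - 2 - l' - g' - t'#} = {#s, - 2 - l' - g' - s#}"
  proof -
    have eq: "{#g', t', - 2 - l' - g' - t'#} = {#p, q, - 2 - l' - p - q#}" using eq1 by simp
    have "g' \<in># {#p, q, - 2 - l' - p - q#}" by (simp flip: eq)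
    then consider "g' = p" | "g' = q" | "g' = - 2 - l' - p - q" by auto
    then show thesis
    proof cases
      case 1 then show thesis using that[of q] \<open>realizes X l' p q\<close> eq by simp
    next
      case 2 then show thesis using that[of p] realizes_swap23[OF 1] eq
        by (simp add: add_mset_commute algebra_simps)
    next
      case 3
      then have p: "p = - 2 - l' - g' - q" by simp
      have "- 2 - p - l' - q = g'" using 3 by simp
      then have "realizes X l' g' q"
        using realizes_swap12[OF realizes_dual1[OF realizes_swap12[OF 1]]] by simp
      moreover have "{#g', q, - 2 - l' - g' - q#} = {#p, q, - 2 - l' - p - q#}"
        unfolding 3[symmetric] p[symmetric] by (simp add: add_mset_commute)
      from trans[OF eq this[symmetric]] have "{#t', - 2 - l' - g' - t'#} = {#q, - 2 - l' - g' - q#}"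
        by simp
      ultimately show thesis by (rule that)
    qed
  qed
  have "t' \<in># {#s, - 2 - l' - g' - s#}" by (simp flip: eq2)
  then consider "t' = s" | "t' = - 2 - l' - g' - s" by auto
  then show ?thesis
  proof cases
    case 2
    then have "- 2 - s - l' - g' = t'" by simp
    then have "realizes X t' l' g'"
      using realizes_dual1[OF realizes_swap12[OF realizes_swap23[OF \<open>realizes X l' g' s\<close>]]] by simp
    then show ?thesis by (rule realizes_swap23[OF realizes_swap12])
  qed (use 2 in simp)
qed

text \<open>
  The target weight \<open>m\<close> enters through the weight \<open>1 - m\<close> of the dual of the target. With this convention
  a dualization merely exchanges two of the four numbers.
\<close>

fun weight_mset :: "weighted_map \<Rightarrow> real multiset" where
  "weight_mset (l, g, t, m, A) = {#l, g, t, 1 - m#}"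

lemma weight_mset_step:
  assumes "perm_dual_step X Y"
  shows "weight_mset Y = weight_mset X"
  using assms
proof cases
  case (perm \<sigma> w l g t m A)
  have i: "inj \<sigma>" "\<sigma> ` {0, 1, 2} = {0, 1, 2}"
    using permutes_inj[OF \<open>\<sigma> permutes {0, 1, 2}\<close>] permutes_image[OF \<open>\<sigma> permutes {0, 1, 2}\<close>] by auto
  have "image_mset ((!) w) (image_mset \<sigma> (mset_set {0, 1, 2})) = image_mset ((!) w) (mset_set {0, 1, 2})"
    using i by (subst image_mset_mset_set) (auto simp: inj_def inj_on_def)
  then show ?thesis using perm by (simp add: add_mset_commute)
qed (auto simp: add_mset_commute)

lemma weight_mset_perm_dual: "perm_dual X Y \<Longrightarrow> weight_mset Y = weight_mset X"
  by (induction rule: rtranclp_induct) (simp_all add: weight_mset_step)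

text \<open>
  The four weights of operators that some permutation or dualization makes exceptional. The weights
  \<open>-2/3, -2/3, -2/3\<close> are included because the fourth weight is then 0, and \<open>a = -1/2\<close> gives the case of
  four equal weights.
\<close>

definition degenerate :: "real multiset \<Rightarrow> bool" where
  "degenerate M \<longleftrightarrow> 0 \<in># M \<or> (\<exists>a. M = {#a, a, - 1 - a, - 1 - a#})"

lemma exceptional_imp_degenerate:
  assumes "exceptional l g t" and sum: "l + g + t + n = - 2"
  shows "degenerate {#l, g, t, n#}"
proof -
  consider "l = 0" | "n = 0" | "l = - 1/2" "g = - 1/2" "t = - 1/2" "n = - 1/2"
    | "g = l" "t = - 1 - l" "n = - 1 - l"
    using assms unfolding exceptional_def by fastforce
  then show ?thesis
  proof cases
    case 3
    then show ?thesis by (auto simp: degenerate_def intro!: exI[of _ "- 1/2"])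
  next
    case 4
    then show ?thesis by (auto simp: degenerate_def)
  qed (simp_all add: degenerate_def)
qed

lemma reachable_exceptional_imp_degenerate:
  assumes "perm_dual (l, g, t, l + g + t + 3, A) (l', g', t', m', C)" and "exceptional l' g' t'"
  shows "degenerate {#l, g, t, - 2 - l - g - t#}"
proof -
  have M: "{#l', g', t', 1 - m'#} = {#l, g, t, - 2 - l - g - t#}"
    using weight_mset_perm_dual[OF assms(1)] by (simp add: algebra_simps)
  then have "sum_mset {#l', g', t', 1 - m'#} = sum_mset {#l, g, t, - 2 - l - g - t#}" by simp
  then have "l' + g' + t' + (1 - m') = - 2" by simp
  then show ?thesis using exceptional_imp_degenerate[OF assms(2)] M by metis
qed

section \<open>Solution of the coefficient system for generic weights\<close>

text \<open>
  The six equations without \<open>\<alpha> 1 1 1\<close> link the six coefficients of type (2,1,0) in a cycle. Scaled by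
  two of the weights, each equation gives the sum of two neighbours in the cycle, and the alternating sum of
  all six is the first conclusion (invariance under $x^4 d/dx$). Hence everything is expressed by
  \<open>P\<close>, \<open>A\<close>, \<open>B\<close>. Of the three equations containing \<open>\<alpha> 1 1 1\<close>, one determines it, and the other two
  become the final two linear relations between \<open>P\<close>, \<open>A\<close> and \<open>B\<close>.
\<close>

lemma reduced_system:
  assumes "coeff_system l g t \<alpha>"
  defines "P \<equiv> l * g * \<alpha> 2 1 0" and "A \<equiv> l * \<alpha> 3 0 0" and "B \<equiv> g * \<alpha> 0 3 0"
  shows "t * \<alpha> 0 0 3 = - A - B"
    and "l * t * \<alpha> 2 0 1 = - 3 * (1 + l) * A - P"
    and "g * t * \<alpha> 0 2 1 = (4 + 3 * l + 3 * t) * A + (1 + 3 * t) * B + P"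
    and "l * g * \<alpha> 1 2 0 = - (4 + 3 * l + 3 * t) * A - (4 + 3 * g + 3 * t) * B - P"
    and "l * t * \<alpha> 1 0 2 = (3 + 3 * t) * A + (4 + 3 * g + 3 * t) * B + P"
    and "g * t * \<alpha> 0 1 2 = - (1 + 3 * g) * B - P"
    and "l * g * t * \<alpha> 1 1 1 = 2 * (g - l) * P + (1 + 2 * g) * ((4 + 3 * l + 3 * t) * A + (4 + 3 * g + 3 * t) * B)"
    and "2 * (2 * l - g - t) * P
      + (3 * (1 + 2 * l) * (1 + l) - (1 + 2 * g) * (4 + 3 * l + 3 * t) - 3 * (1 + 2 * t) * (1 + t)) * A
      + (- 2 * (1 + g + t) * (4 + 3 * g + 3 * t)) * B = 0"
    and "2 * (l + t - 2 * g) * P + (- 2 * (1 + 2 * g) * (4 + 3 * l + 3 * t)) * A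
      + ((1 + 2 * t) * (1 + 3 * g) - (1 + 2 * g) * (5 + 3 * g + 6 * t)) * B = 0"
proof -
  note e = assms(1)[unfolded coeff_system_def]
  show C: "t * \<alpha> 0 0 3 = - A - B" using e unfolding A_def B_def by algebra
  show Q: "l * t * \<alpha> 2 0 1 = - 3 * (1 + l) * A - P" using e unfolding P_def A_def B_def by algebra
  show R: "g * t * \<alpha> 0 2 1 = (4 + 3 * l + 3 * t) * A + (1 + 3 * t) * B + P" 
    using e Q C unfolding P_def A_def B_def by algebra
  show P': "l * g * \<alpha> 1 2 0 = - (4 + 3 * l + 3 * t) * A - (4 + 3 * g + 3 * t) * B - P"
    using e R unfolding P_def A_def B_def by algebra
  show Q': "l * t * \<alpha> 1 0 2 = (3 + 3 * t) * A + (4 + 3 * g + 3 * t) * B + P"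
    using e P' unfolding P_def A_def B_def by algebra
  show R': "g * t * \<alpha> 0 1 2 = - (1 + 3 * g) * B - P"
    using e unfolding P_def A_def B_def by algebra
  show E: "l * g * t * \<alpha> 1 1 1 = 2 * (g - l) * P + (1 + 2 * g) * ((4 + 3 * l + 3 * t) * A + (4 + 3 * g + 3 * t) * B)"
    using e P' unfolding P_def A_def B_def by algebra
  \<comment> \<open>the other two equations containing \<open>\<alpha> 1 1 1\<close>\<close>
  have E2: "(1 + 2 * l) * (l * t * \<alpha> 2 0 1) + l * g * t * \<alpha> 1 1 1 + (1 + 2 * t) * (l * t * \<alpha> 1 0 2) = 0"
    using e by algebra
  have E3: "l * g * t * \<alpha> 1 1 1 + (1 + 2 * g) * (g * t * \<alpha> 0 2 1) + (1 + 2 * t) * (g * t * \<alpha> 0 1 2) = 0"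
    using e by algebra
  show "2 * (2 * l - g - t) * P
      + (3 * (1 + 2 * l) * (1 + l) - (1 + 2 * g) * (4 + 3 * l + 3 * t) - 3 * (1 + 2 * t) * (1 + t)) * A
      + (- 2 * (1 + g + t) * (4 + 3 * g + 3 * t)) * B = 0"
    using E2 unfolding Q Q' E by algebra
  show "2 * (l + t - 2 * g) * P + (- 2 * (1 + 2 * g) * (4 + 3 * l + 3 * t)) * A
      + ((1 + 2 * t) * (1 + 3 * g) - (1 + 2 * g) * (5 + 3 * g + 6 * t)) * B = 0"
    using E3 unfolding R R' E by algebra
qed

lemma coeff_system_scale:
  "coeff_system l g t \<alpha> \<Longrightarrow> coeff_system l g t (\<lambda>i j n. c * \<alpha> i j n)"
  unfolding coeff_system_def by (elim conjE, intro conjI; algebra)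

text \<open>
  For nonzero weights the scaling in the reduced system can be undone.
\<close>

lemma coeff_system_unique:
  assumes "coeff_system l g t \<alpha>" "coeff_system l g t \<beta>"
    and nz: "l \<noteq> 0" "g \<noteq> 0" "t \<noteq> 0"
    and eq: "\<alpha> 3 0 0 = \<beta> 3 0 0" "\<alpha> 0 3 0 = \<beta> 0 3 0" "\<alpha> 2 1 0 = \<beta> 2 1 0"
    and "i + j + n = 3"
  shows "\<alpha> i j n = \<beta> i j n"
proof -
  note a = reduced_system[OF assms(1)] and b = reduced_system[OF assms(2)]
  have "l * t \<noteq> 0" "g * t \<noteq> 0" "l * g \<noteq> 0" "l * g * t \<noteq> 0" using nz by auto
  note cancel = mult_left_cancel[THEN iffD1, OF nz(3)] this[THEN mult_left_cancel[THEN iffD1]]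
  have "\<alpha> 0 0 3 = \<beta> 0 0 3" by (rule cancel(1)) (simp only: a(1) b(1) eq)
  moreover have "\<alpha> 2 0 1 = \<beta> 2 0 1" by (rule cancel(2)) (simp only: a(2) b(2) eq)
  moreover have "\<alpha> 0 2 1 = \<beta> 0 2 1" by (rule cancel(3)) (simp only: a(3) b(3) eq)
  moreover have "\<alpha> 1 2 0 = \<beta> 1 2 0" by (rule cancel(4)) (simp only: a(4) b(4) eq)
  moreover have "\<alpha> 1 0 2 = \<beta> 1 0 2" by (rule cancel(2)) (simp only: a(5) b(5) eq)
  moreover have "\<alpha> 0 1 2 = \<beta> 0 1 2" by (rule cancel(3)) (simp only: a(6) b(6) eq)
  moreover have "\<alpha> 1 1 1 = \<beta> 1 1 1" by (rule cancel(5)) (simp only: a(7) b(7) eq)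
  ultimately show ?thesis
    using degree_3_cases[OF \<open>i + j + n = 3\<close>] eq
    by (elim insertE emptyE Pair_inject) (hypsubst, assumption)+
qed

lemma hom_op_eqI:
  assumes "\<And>i j n. i + j + n = 3 \<Longrightarrow> \<alpha> i j n = \<beta> i j n"
  shows "hom_op \<alpha> = hom_op \<beta>"
  unfolding hom_op_def by (rule diff_op_cong) (simp add: assms)

definition Delta3_coeffs :: "real \<Rightarrow> real \<Rightarrow> real \<Rightarrow> nat \<Rightarrow> nat \<Rightarrow> nat \<Rightarrow> real" where
  "Delta3_coeffs l g t i j n =
    (if (i, j, n) = (3, 0, 0) then g * t * (t - g) * (1 + g + t)
     else if (i, j, n) = (0, 3, 0) then l * t * (l - t) * (1 + l + t)
     else if (i, j, n) = (0, 0, 3) then g * l * (g - l) * (1 + g + l)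
     else if (i, j, n) = (1, 1, 1) then (l - g) * (g - t) * (l - t)
     else if (i, j, n) = (2, 1, 0) then t * (1 + g + t) * (2 * l + t + g * (3 * l + 3 * t + 4) + 2)
     else if (i, j, n) = (1, 2, 0) then - t * (1 + l + t) * (2 * g + t + l * (3 * g + 3 * t + 4) + 2)
     else if (i, j, n) = (2, 0, 1) then - g * (1 + g + t) * (g + 2 * l + (3 * g + 3 * l + 4) * t + 2)
     else if (i, j, n) = (1, 0, 2) then g * (1 + g + l) * (g + 2 * t + l * (3 * g + 3 * t + 4) + 2)
     else if (i, j, n) = (0, 2, 1) then l * (1 + l + t) * (2 * g + l + (3 * g + 3 * l + 4) * t + 2)
     else if (i, j, n) = (0, 1, 2) then - l * (1 + g + l) * (l + 2 * t + g * (3 * l + 3 * t + 4) + 2)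
     else 0)"

lemma Delta3_coeffs_simps:
  "Delta3_coeffs l g t 3 0 0 = g * t * (t - g) * (1 + g + t)"
  "Delta3_coeffs l g t 0 3 0 = l * t * (l - t) * (1 + l + t)"
  "Delta3_coeffs l g t 0 0 3 = g * l * (g - l) * (1 + g + l)"
  "Delta3_coeffs l g t 1 1 1 = (l - g) * (g - t) * (l - t)"
  "Delta3_coeffs l g t 2 1 0 = t * (1 + g + t) * (2 * l + t + g * (3 * l + 3 * t + 4) + 2)"
  "Delta3_coeffs l g t 1 2 0 = - t * (1 + l + t) * (2 * g + t + l * (3 * g + 3 * t + 4) + 2)"
  "Delta3_coeffs l g t 2 0 1 = - g * (1 + g + t) * (g + 2 * l + (3 * g + 3 * l + 4) * t + 2)"
  "Delta3_coeffs l g t 1 0 2 = g * (1 + g + l) * (g + 2 * t + l * (3 * g + 3 * t + 4) + 2)"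
  "Delta3_coeffs l g t 0 2 1 = l * (1 + l + t) * (2 * g + l + (3 * g + 3 * l + 4) * t + 2)"
  "Delta3_coeffs l g t 0 1 2 = - l * (1 + g + l) * (l + 2 * t + g * (3 * l + 3 * t + 4) + 2)"
  by (simp_all add: Delta3_coeffs_def)

lemma Delta3_eq_hom_op: "Delta3 l g t = hom_op (Delta3_coeffs l g t)"
  by (intro ext real_poly_eqI)
    (simp only: poly_hom_op Delta3_coeffs_simps Delta3_def poly_add poly_smult poly_mult)

lemma coeff_system_Delta3: "coeff_system l g t (Delta3_coeffs l g t)"
  unfolding coeff_system_def Delta3_coeffs_simps by (intro conjI; algebra)

text \<open>
  The coefficients at $\varphi'''$, $\psi'''$, $\chi'''$ and $\varphi'\psi'\chi'$ are products of linear
  factors, whose vanishing says that two weights agree or add up to \<open>-1\<close>. If all three agree, the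
  coefficient at $\varphi''\psi'$ leaves \<open>-1/2\<close> and \<open>-2/3\<close>, and for \<open>-2/3\<close> the fourth weight is 0.
\<close>

lemma Delta3_coeffs_zero:
  assumes nz: "l \<noteq> 0" "g \<noteq> 0" "t \<noteq> 0" "- 2 - l - g - t \<noteq> 0"
    and 0: "\<And>i j n. i + j + n = 3 \<Longrightarrow> Delta3_coeffs l g t i j n = 0"
  shows "\<exists>a. {#l, g, t, - 2 - l - g - t#} = {#a, a, - 1 - a, - 1 - a#}"
proof -
  have A: "t = g \<or> t = - 1 - g" using 0[of 3 0 0] nz unfolding Delta3_coeffs_simps by simp linarith
  have B: "t = l \<or> t = - 1 - l" using 0[of 0 3 0] nz unfolding Delta3_coeffs_simps by simp linarith
  have C: "g = l \<or> g = - 1 - l" using 0[of 0 0 3] nz unfolding Delta3_coeffs_simps by simp linarith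
  have E: "l = g \<or> g = t \<or> l = t" using 0[of 1 1 1] unfolding Delta3_coeffs_simps by simp
  show ?thesis
  proof (cases "l = g \<and> g = t")
    case True
    then have "(1 + 2 * l) * ((1 + 2 * l) * (2 + 3 * l)) = 0"
      using 0[of 2 1 0] nz True unfolding Delta3_coeffs_simps by simp algebra
    moreover have "2 + 3 * l \<noteq> 0" using nz True by simp
    ultimately have "l = - 1/2" by simp
    then show ?thesis using True by (intro exI[of _ "- 1/2"]) simp
  next
    case False
    then consider "l = g" "t = - 1 - l" | "g = t" "g = - 1 - l" | "l = t" "g = - 1 - l"
      using A B C E by auto
    then show ?thesis
      by cases (auto intro!: exI[of _ l])
  qed
qed

lemma parallel_if_orthogonal:
  fixes x y z k :: real
  assumes n: "n1 * x + n2 * y + n3 * z = 0" and m: "m1 * x + m2 * y + m3 * z = 0"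
    and cross: "n2 * m3 - n3 * m2 = k * x'" "n3 * m1 - n1 * m3 = k * y'" "n1 * m2 - n2 * m1 = k * z'"
  shows "k * (y * z' - z * y') = 0" "k * (x * y' - y * x') = 0" "k * (x * z' - z * x') = 0"
proof -
  have "k * (y * z' - z * y') = y * (k * z') - z * (k * y')" by (simp add: algebra_simps)
  also have "\<dots> = n1 * (m1 * x + m2 * y + m3 * z) - m1 * (n1 * x + n2 * y + n3 * z)"
    unfolding cross[symmetric] by (simp add: algebra_simps)
  finally show "k * (y * z' - z * y') = 0" by (simp add: n m)
  have "k * (x * y' - y * x') = x * (k * y') - y * (k * x')" by (simp add: algebra_simps)
  also have "\<dots> = n3 * (m1 * x + m2 * y + m3 * z) - m3 * (n1 * x + n2 * y + n3 * z)"
    unfolding cross[symmetric] by (simp add: algebra_simps)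
  finally show "k * (x * y' - y * x') = 0" by (simp add: n m)
  have "k * (x * z' - z * x') = x * (k * z') - z * (k * x')" by (simp add: algebra_simps)
  also have "\<dots> = m2 * (n1 * x + n2 * y + n3 * z) - n2 * (m1 * x + m2 * y + m3 * z)"
    unfolding cross[symmetric] by (simp add: algebra_simps)
  finally show "k * (x * z' - z * x') = 0" by (simp add: n m)
qed

text \<open>
  The two linear relations of the reduced system say that \<open>(P, A, B)\<close> is orthogonal to two vectors. Their
  cross product is \<open>12 (- 2 - l - g - t)\<close> times the vector that belongs to the generic operator. So, as long
  as the fourth weight is not 0 and the generic operator does not vanish, every solution is a multiple of it.
\<close>

lemma generic_solution:
  assumes sol: "coeff_system l g t \<alpha>"
    and nz: "l \<noteq> 0" "g \<noteq> 0" "t \<noteq> 0" "- 2 - l - g - t \<noteq> 0"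
    and gen: "\<nexists>a. {#l, g, t, - 2 - l - g - t#} = {#a, a, - 1 - a, - 1 - a#}"
  shows "\<exists>c. hom_op \<alpha> = hom_op (\<lambda>i j n. c * Delta3_coeffs l g t i j n)"
proof -
  let ?D = "Delta3_coeffs l g t"
  define P A B where "P = l * g * \<alpha> 2 1 0" and "A = l * \<alpha> 3 0 0" and "B = g * \<alpha> 0 3 0"
  \<comment> \<open>the same three quantities for the generic operator, divided by \<open>l * g * t\<close>\<close>
  define P' A' B' where "P' = (1 + g + t) * (2 * l + t + g * (3 * l + 3 * t + 4) + 2)"
    and "A' = (t - g) * (1 + g + t)" and "B' = (l - t) * (1 + l + t)"
  have D: "?D 2 1 0 = t * P'" "?D 3 0 0 = g * t * A'" "?D 0 3 0 = l * t * B'"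
    unfolding Delta3_coeffs_simps P'_def A'_def B'_def by simp_all
  \<comment> \<open>the coefficients of the two linear relations\<close>
  define nP nA nB where "nP = 2 * (2 * l - g - t)"
    and "nA = 3 * (1 + 2 * l) * (1 + l) - (1 + 2 * g) * (4 + 3 * l + 3 * t) - 3 * (1 + 2 * t) * (1 + t)"
    and "nB = - 2 * (1 + g + t) * (4 + 3 * g + 3 * t)"
  define mP mA mB where "mP = 2 * (l + t - 2 * g)"
    and "mA = - 2 * (1 + 2 * g) * (4 + 3 * l + 3 * t)"
    and "mB = (1 + 2 * t) * (1 + 3 * g) - (1 + 2 * g) * (5 + 3 * g + 6 * t)"
  have n: "nP * P + nA * A + nB * B = 0" and m: "mP * P + mA * A + mB * B = 0"
    unfolding nP_def nA_def nB_def mP_def mA_def mB_def P_def A_def B_def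
    by (rule reduced_system(8)[OF sol], rule reduced_system(9)[OF sol])
  have cross: "nA * mB - nB * mA = 12 * (- 2 - l - g - t) * P'"
      "nB * mP - nP * mB = 12 * (- 2 - l - g - t) * A'"
      "nP * mA - nA * mP = 12 * (- 2 - l - g - t) * B'"
    unfolding nP_def nA_def nB_def mP_def mA_def mB_def P'_def A'_def B'_def by algebra+
  have "12 * (- 2 - l - g - t) * (A * B' - B * A') = 0"
    using parallel_if_orthogonal(1)[OF n m cross] .
  moreover have "12 * (- 2 - l - g - t) * (P * A' - A * P') = 0"
    using parallel_if_orthogonal(2)[OF n m cross] .
  moreover have "12 * (- 2 - l - g - t) * (P * B' - B * P') = 0"
    using parallel_if_orthogonal(3)[OF n m cross] .
  ultimately have par: "A * B' = B * A'" "P * A' = A * P'" "P * B' = B * P'" using nz by auto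
  have "A' \<noteq> 0 \<or> B' \<noteq> 0 \<or> P' \<noteq> 0"
  proof (rule ccontr)
    assume "\<not> ?thesis"
    then have "?D 3 0 0 = 0 * ?D 3 0 0" "?D 0 3 0 = 0 * ?D 0 3 0" "?D 2 1 0 = 0 * ?D 2 1 0" unfolding D by simp_all
    then have "?D i j n = 0 * ?D i j n" if "i + j + n = 3" for i j n
      using that by (rule coeff_system_unique[OF coeff_system_Delta3
          coeff_system_scale[OF coeff_system_Delta3] nz(1-3)])
    then show False using Delta3_coeffs_zero[OF nz] gen by simp
  qed
  then obtain k where k: "A = k * A'" "B = k * B'" "P = k * P'"
  proof (elim disjE)
    assume "A' \<noteq> 0" then show thesis using that[of "A / A'"] par by (simp add: field_simps)
  next
    assume "B' \<noteq> 0" then show thesis using that[of "B / B'"] par by (simp add: field_simps)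
  next
    assume "P' \<noteq> 0" then show thesis using that[of "P / P'"] par by (simp add: field_simps)
  qed
  \<comment> \<open>the factor \<open>k\<close> relates the scaled quantities\<close>
  define c where "c = k / (l * g * t)"
  have "\<alpha> 3 0 0 = c * ?D 3 0 0" "\<alpha> 0 3 0 = c * ?D 0 3 0" "\<alpha> 2 1 0 = c * ?D 2 1 0"
    using k nz unfolding D c_def A_def B_def P_def by (simp_all add: field_simps)
  then have "hom_op \<alpha> = hom_op (\<lambda>i j n. c * ?D i j n)"
    by (rule hom_op_eqI[OF coeff_system_unique[OF sol coeff_system_scale[OF coeff_system_Delta3] nz(1-3)]])
  then show ?thesis by blast
qed

section \<open>Solution of the coefficient system for exceptional weights\<close>

lemmas density_op_simps = Poisson_def deRham_def dens_mult_def Grozman_def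
  pderiv_mult pderiv_add pderiv_diff pderiv_smult pderiv_minus numeral_2_eq_2 numeral_3_eq_3

lemma zero_weights_solution:
  assumes "coeff_system 0 0 0 \<alpha>"
  shows "\<exists>\<epsilon>1 \<epsilon>2 \<epsilon>3 \<epsilon>4. \<forall>\<phi> \<psi> \<chi>. hom_op \<alpha> \<phi> \<psi> \<chi> =
          smult \<epsilon>1 (coef (\<lbrace>deRham (Dens \<phi> 0), deRham (Dens \<psi> 0)\<rbrace> \<odot> Dens \<chi> 0))
        + smult \<epsilon>2 (coef (\<lbrace>deRham (Dens \<chi> 0), deRham (Dens \<phi> 0)\<rbrace> \<odot> Dens \<psi> 0))
        + smult \<epsilon>3 (coef (\<lbrace>deRham (Dens \<psi> 0), deRham (Dens \<chi> 0)\<rbrace> \<odot> Dens \<phi> 0))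
        + smult \<epsilon>4 (coef (deRham (Dens \<phi> 0) \<odot> deRham (Dens \<psi> 0) \<odot> deRham (Dens \<chi> 0)))"
proof -
  note e = assms[unfolded coeff_system_def]
  have "\<alpha> 3 0 0 = 0" "\<alpha> 0 3 0 = 0" "\<alpha> 0 0 3 = 0" using e by simp_all
  moreover have "\<alpha> 1 2 0 = - \<alpha> 2 1 0" "\<alpha> 2 0 1 = - \<alpha> 1 0 2" "\<alpha> 0 1 2 = - \<alpha> 0 2 1" using e by argo+
  ultimately have "poly (hom_op \<alpha> \<phi> \<psi> \<chi>) x = poly (
          smult (\<alpha> 2 1 0) (coef (\<lbrace>deRham (Dens \<phi> 0), deRham (Dens \<psi> 0)\<rbrace> \<odot> Dens \<chi> 0))
        + smult (\<alpha> 1 0 2) (coef (\<lbrace>deRham (Dens \<chi> 0), deRham (Dens \<phi> 0)\<rbrace> \<odot> Dens \<psi> 0))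
        + smult (\<alpha> 0 2 1) (coef (\<lbrace>deRham (Dens \<psi> 0), deRham (Dens \<chi> 0)\<rbrace> \<odot> Dens \<phi> 0))
        + smult (\<alpha> 1 1 1) (coef (deRham (Dens \<phi> 0) \<odot> deRham (Dens \<psi> 0) \<odot> deRham (Dens \<chi> 0)))) x" 
    for \<phi> \<psi> \<chi> x
    by (simp only: poly_hom_op) (simp add: density_op_simps, simp add: algebra_simps)
  then show ?thesis using real_poly_eqI by blast
qed

lemma Grozman_solution:
  assumes "coeff_system (-2/3) (-2/3) (-2/3) \<alpha>"
  shows "\<exists>\<epsilon>1 \<epsilon>2 \<epsilon>3. \<forall>\<phi> \<psi> \<chi>. hom_op \<alpha> \<phi> \<psi> \<chi> =
          smult \<epsilon>1 (coef (Grozman (Dens \<phi> (-2/3)) (Dens \<psi> (-2/3)) \<odot> Dens \<chi> (-2/3)))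
        + smult \<epsilon>2 (coef (Grozman (Dens \<chi> (-2/3)) (Dens \<phi> (-2/3)) \<odot> Dens \<psi> (-2/3)))
        + smult \<epsilon>3 (coef (Grozman (Dens \<psi> (-2/3)) (Dens \<chi> (-2/3)) \<odot> Dens \<phi> (-2/3)))"
proof -
  \<comment> \<open>$\varphi''\psi'\chi$, $\varphi'\psi\chi''$ and $\varphi\psi''\chi'$ each occur in one of the three operators only\<close>
  define \<epsilon>1 \<epsilon>2 \<epsilon>3 where "\<epsilon>1 = \<alpha> 2 1 0 / 3" and "\<epsilon>2 = \<alpha> 1 0 2 / 3" and "\<epsilon>3 = \<alpha> 0 2 1 / 3"
  note e = assms[unfolded coeff_system_def] and d = \<epsilon>1_def \<epsilon>2_def \<epsilon>3_def
  have c: "\<alpha> 2 1 0 = 3 * \<epsilon>1" "\<alpha> 1 0 2 = 3 * \<epsilon>2" "\<alpha> 0 2 1 = 3 * \<epsilon>3"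
    "\<alpha> 1 2 0 = - 3 * \<epsilon>1" "\<alpha> 2 0 1 = - 3 * \<epsilon>2" "\<alpha> 0 1 2 = - 3 * \<epsilon>3"
    "\<alpha> 3 0 0 = 2 * \<epsilon>1 - 2 * \<epsilon>2" "\<alpha> 0 3 0 = 2 * \<epsilon>3 - 2 * \<epsilon>1" "\<alpha> 0 0 3 = 2 * \<epsilon>2 - 2 * \<epsilon>3" 
    "\<alpha> 1 1 1 = 0"
    using e d by argo+
  have "poly (hom_op \<alpha> \<phi> \<psi> \<chi>) x = poly (
          smult \<epsilon>1 (coef (Grozman (Dens \<phi> (-2/3)) (Dens \<psi> (-2/3)) \<odot> Dens \<chi> (-2/3)))
        + smult \<epsilon>2 (coef (Grozman (Dens \<chi> (-2/3)) (Dens \<phi> (-2/3)) \<odot> Dens \<psi> (-2/3)))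
        + smult \<epsilon>3 (coef (Grozman (Dens \<psi> (-2/3)) (Dens \<chi> (-2/3)) \<odot> Dens \<phi> (-2/3)))) x" for \<phi> \<psi> \<chi> x
    by (simp only: poly_hom_op c) (simp add: density_op_simps, simp add: algebra_simps)
  then show ?thesis using real_poly_eqI by blast
qed

lemma half_weights_solution:
  assumes "coeff_system (-1/2) (-1/2) (-1/2) \<alpha>"
  shows "\<exists>\<epsilon>1 \<epsilon>2 \<epsilon>3. \<forall>\<phi> \<psi> \<chi>. hom_op \<alpha> \<phi> \<psi> \<chi> =
          smult \<epsilon>1 (coef \<lbrace>deRham \<lbrace>Dens \<phi> (-1/2), Dens \<psi> (-1/2)\<rbrace>, Dens \<chi> (-1/2)\<rbrace>)
        + smult \<epsilon>2 (coef \<lbrace>deRham \<lbrace>Dens \<chi> (-1/2), Dens \<phi> (-1/2)\<rbrace>, Dens \<psi> (-1/2)\<rbrace>)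
        + smult \<epsilon>3 (coef \<lbrace>deRham \<lbrace>Dens \<psi> (-1/2), Dens \<chi> (-1/2)\<rbrace>, Dens \<phi> (-1/2)\<rbrace>)"
proof -
  \<comment> \<open>solved for from the expressions for \<open>\<alpha> 3 0 0\<close>, \<open>\<alpha> 0 3 0\<close> and \<open>\<alpha> 2 1 0\<close> below\<close>
  define \<epsilon>2 where "\<epsilon>2 = 4 * \<alpha> 3 0 0 - 4 * \<alpha> 2 1 0"
  define \<epsilon>1 where "\<epsilon>1 = 4 * \<alpha> 3 0 0 + \<epsilon>2"
  define \<epsilon>3 where "\<epsilon>3 = 4 * \<alpha> 0 3 0 + \<epsilon>1"
  note e = assms[unfolded coeff_system_def] and d = \<epsilon>1_def \<epsilon>2_def \<epsilon>3_def
  have c: "\<alpha> 3 0 0 = \<epsilon>1 / 4 - \<epsilon>2 / 4" "\<alpha> 0 3 0 = \<epsilon>3 / 4 - \<epsilon>1 / 4" "\<alpha> 0 0 3 = \<epsilon>2 / 4 - \<epsilon>3 / 4" 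
    "\<alpha> 2 1 0 = \<epsilon>1 / 4 - \<epsilon>2 / 2" "\<alpha> 1 2 0 = \<epsilon>3 / 2 - \<epsilon>1 / 4"
    "\<alpha> 2 0 1 = \<epsilon>1 / 2 - \<epsilon>2 / 4" "\<alpha> 1 0 2 = \<epsilon>2 / 4 - \<epsilon>3 / 2"
    "\<alpha> 0 2 1 = \<epsilon>3 / 4 - \<epsilon>1 / 2" "\<alpha> 0 1 2 = \<epsilon>2 / 2 - \<epsilon>3 / 4"
    "\<alpha> 1 1 1 = 0"
    using e d by argo+
  have "poly (hom_op \<alpha> \<phi> \<psi> \<chi>) x = poly (
          smult \<epsilon>1 (coef \<lbrace>deRham \<lbrace>Dens \<phi> (-1/2), Dens \<psi> (-1/2)\<rbrace>, Dens \<chi> (-1/2)\<rbrace>)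
        + smult \<epsilon>2 (coef \<lbrace>deRham \<lbrace>Dens \<chi> (-1/2), Dens \<phi> (-1/2)\<rbrace>, Dens \<psi> (-1/2)\<rbrace>)
        + smult \<epsilon>3 (coef \<lbrace>deRham \<lbrace>Dens \<psi> (-1/2), Dens \<chi> (-1/2)\<rbrace>, Dens \<phi> (-1/2)\<rbrace>)) x" for \<phi> \<psi> \<chi> x
    by (simp only: poly_hom_op c) (simp add: density_op_simps, simp add: algebra_simps add_divide_distrib diff_divide_distrib)
  then show ?thesis using real_poly_eqI by blast
qed

text \<open>
  For $\lambda = 0$ the terms without derivative of $\varphi$ form an invariant binary operator of order 3
  in $\psi$ and $\chi$, and for nonzero weights \<open>g\<close>, \<open>t\<close> only the Grozman operator is of this kind.
\<close>

lemma no_binary_part_of_order_3: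
  assumes sol: "coeff_system 0 g t \<alpha>" and g: "g \<noteq> 0" and t: "t \<noteq> 0" and gt: "\<not> (g = - 2/3 \<and> t = - 2/3)"
  shows "\<alpha> 0 3 0 = 0" "\<alpha> 0 0 3 = 0" "\<alpha> 0 2 1 = 0" "\<alpha> 0 1 2 = 0"
proof -
  note e = sol[unfolded coeff_system_def, simplified mult_zero_left add_0_left add_0_right]
  have 1: "g * \<alpha> 0 3 0 * (4 + 3 * g + 3 * t) = 0" using e by algebra
  have 2: "\<alpha> 0 3 0 * (3 * (1 + 2 * g) * (1 + g) + (1 + 2 * t) * (1 + 3 * g)) = 0" using e by algebra
  show b: "\<alpha> 0 3 0 = 0"
  proof (rule ccontr)
    assume "\<alpha> 0 3 0 \<noteq> 0"
    \<comment> \<open>the Grozman weights are the only common zero of both factors\<close>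
    then have "t = - 4/3 - g" "3 * (1 + 2 * g) * (1 + g) + (1 + 2 * t) * (1 + 3 * g) = 0"
      using 1 2 g by auto
    then have "4/3 + 2 * g = 0" by algebra
    then show False using \<open>t = - 4/3 - g\<close> gt by simp
  qed
  have "t * \<alpha> 0 2 1 = 0" "t * \<alpha> 0 1 2 = 0" using e b by auto
  then show rr: "\<alpha> 0 2 1 = 0" "\<alpha> 0 1 2 = 0" using t by auto
  have "(1 + t) * \<alpha> 0 0 3 = 0" "(1 + 3 * t) * \<alpha> 0 0 3 = 0" using e rr by auto
  then show "\<alpha> 0 0 3 = 0" by algebra
qed

lemma deRham_family_eq:
  assumes z: "\<alpha> 0 3 0 = 0" "\<alpha> 0 0 3 = 0" "\<alpha> 0 2 1 = 0" "\<alpha> 0 1 2 = 0"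
    and c: "\<alpha> 3 0 0 = g * t * \<epsilon>1 + g * t * \<epsilon>2"
     "\<alpha> 2 1 0 = t * (g - 1) * \<epsilon>1 - t * (t + 2) * \<epsilon>2"
     "\<alpha> 1 2 0 = - t * \<epsilon>1" 
     "\<alpha> 1 1 1 = (g + 2) * \<epsilon>1 + (t + 2) * \<epsilon>2"
     "\<alpha> 2 0 1 = - g * (g + 2) * \<epsilon>1 + g * (t - 1) * \<epsilon>2"
     "\<alpha> 1 0 2 = - g * \<epsilon>2"
  shows "hom_op \<alpha> \<phi> \<psi> \<chi> =
          smult \<epsilon>1 (coef \<lbrace>\<lbrace>deRham (Dens \<phi> 0), Dens \<psi> g\<rbrace>, Dens \<chi> t\<rbrace>)
        + smult \<epsilon>2 (coef \<lbrace>\<lbrace>deRham (Dens \<phi> 0), Dens \<chi> t\<rbrace>, Dens \<psi> g\<rbrace>)"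
  by (rule real_poly_eqI)
    (simp only: poly_hom_op z c, simp add: density_op_simps, simp add: algebra_simps)

lemma deRham_solution:
  assumes sol: "coeff_system 0 g t \<alpha>" and g: "g \<noteq> 0" and t: "t \<noteq> 0" and gt: "\<not> (g = - 2/3 \<and> t = - 2/3)"
  shows "\<exists>\<epsilon>1 \<epsilon>2. \<forall>\<phi> \<psi> \<chi>. hom_op \<alpha> \<phi> \<psi> \<chi> =
          smult \<epsilon>1 (coef \<lbrace>\<lbrace>deRham (Dens \<phi> 0), Dens \<psi> g\<rbrace>, Dens \<chi> t\<rbrace>)
        + smult \<epsilon>2 (coef \<lbrace>\<lbrace>deRham (Dens \<phi> 0), Dens \<chi> t\<rbrace>, Dens \<psi> g\<rbrace>)"
proof -
  \<comment> \<open>$\varphi'\psi''\chi$ occurs only in the first operator, $\varphi'\psi\chi''$ only in the second\<close>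
  define \<epsilon>1 \<epsilon>2 where "\<epsilon>1 = - \<alpha> 1 2 0 / t" and "\<epsilon>2 = - \<alpha> 1 0 2 / g"
  have p: "\<alpha> 1 2 0 = - t * \<epsilon>1" "\<alpha> 1 0 2 = - g * \<epsilon>2"
    using g t by (simp_all add: \<epsilon>1_def \<epsilon>2_def)
  note e = sol[unfolded coeff_system_def, simplified mult_zero_left add_0_left add_0_right mult_zero_right p]
  have a: "\<alpha> 3 0 0 = g * t * \<epsilon>1 + g * t * \<epsilon>2" using e by algebra
  have "g * t * (\<alpha> 1 1 1 - ((g + 2) * \<epsilon>1 + (t + 2) * \<epsilon>2)) = 0" using e by algebra
  then have E: "\<alpha> 1 1 1 = (g + 2) * \<epsilon>1 + (t + 2) * \<epsilon>2" using g t by simp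
  have "\<alpha> 2 1 0 = t * (g - 1) * \<epsilon>1 - t * (t + 2) * \<epsilon>2"
     "\<alpha> 2 0 1 = - g * (g + 2) * \<epsilon>1 + g * (t - 1) * \<epsilon>2" using e E by algebra+
  note deRham_family_eq[OF no_binary_part_of_order_3[OF sol g t gt] a this(1) p(1) E this(2) p(2)]
  then show ?thesis by blast
qed

text \<open>
  For \<open>g = 0\<close> the coefficient \<open>\<alpha> 1 0 2\<close> vanishes on the whole family and cannot determine the second
  parameter; \<open>\<alpha> 1 1 1\<close> does so instead, unless \<open>t = - 2\<close>, where the second operator is zero and the weights
  are dual to \<open>(0, 0, 0)\<close>.
\<close>

lemma two_zero_weights_solution:
  assumes sol: "coeff_system 0 0 t \<alpha>" and t: "t \<noteq> 0" and t2: "t \<noteq> - 2"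
  shows "\<exists>\<epsilon>1 \<epsilon>2. \<forall>\<phi> \<psi> \<chi>. hom_op \<alpha> \<phi> \<psi> \<chi> =
          smult \<epsilon>1 (coef \<lbrace>\<lbrace>deRham (Dens \<phi> 0), Dens \<psi> 0\<rbrace>, Dens \<chi> t\<rbrace>)
        + smult \<epsilon>2 (coef \<lbrace>\<lbrace>deRham (Dens \<phi> 0), Dens \<chi> t\<rbrace>, Dens \<psi> 0\<rbrace>)"
proof -
  define \<epsilon>1 \<epsilon>2 where "\<epsilon>1 = - \<alpha> 1 2 0 / t" and "\<epsilon>2 = (\<alpha> 1 1 1 - 2 * \<epsilon>1) / (t + 2)"
  have t2': "t + 2 \<noteq> 0" using t2 by linarith
  have p: "\<alpha> 1 2 0 = - t * \<epsilon>1" "\<alpha> 1 1 1 = 2 * \<epsilon>1 + (t + 2) * \<epsilon>2"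
    using t t2' by (simp_all add: \<epsilon>1_def \<epsilon>2_def)
  note e = sol[unfolded coeff_system_def, simplified mult_zero_left add_0_left add_0_right mult_zero_right p]
  have "\<alpha> 0 3 0 * (t + 2) = 0" "\<alpha> 0 0 3 = 0" "t * (t + 2) * \<alpha> 1 0 2 = 0" using e by algebra+
  then have z: "\<alpha> 0 3 0 = 0" "\<alpha> 0 0 3 = 0" "\<alpha> 1 0 2 = 0" using t t2' by simp_all
  have "t * \<alpha> 0 2 1 = 0" "t * \<alpha> 0 1 2 = 0" "\<alpha> 2 0 1 = 0" "\<alpha> 3 0 0 = 0" using e z by auto
  moreover have "\<alpha> 2 1 0 = - t * \<epsilon>1 - t * (t + 2) * \<epsilon>2" using e by algebra
  ultimately have "hom_op \<alpha> \<phi> \<psi> \<chi> =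
          smult \<epsilon>1 (coef \<lbrace>\<lbrace>deRham (Dens \<phi> 0), Dens \<psi> 0\<rbrace>, Dens \<chi> t\<rbrace>)
        + smult \<epsilon>2 (coef \<lbrace>\<lbrace>deRham (Dens \<phi> 0), Dens \<chi> t\<rbrace>, Dens \<psi> 0\<rbrace>)" for \<phi> \<psi> \<chi>
    using t z p by (intro deRham_family_eq) (simp_all only: mult_eq_0_iff, simp_all)
  then show ?thesis by blast
qed

text \<open>
  Since \<open>1 + g + t = 0\<close> and \<open>l = g\<close>, one of the two linear relations of the reduced system loses its term in
  \<open>B\<close> and determines \<open>P\<close> from \<open>A\<close>. Thus \<open>\<alpha> 3 0 0\<close> and \<open>\<alpha> 0 3 0\<close> determine the solution, and each of
  them occurs in exactly one of the two operators.
\<close>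

lemma paired_weights_solution:
  assumes sol: "coeff_system a a (- 1 - a) \<alpha>" and a: "a \<noteq> 0" and t: "- 1 - a \<noteq> 0" and at: "a \<noteq> - 1 - a"
  shows "\<exists>\<epsilon>1 \<epsilon>2. \<forall>\<phi> \<psi> \<chi>. hom_op \<alpha> \<phi> \<psi> \<chi> =
          smult \<epsilon>1 (coef \<lbrace>deRham \<lbrace>Dens \<phi> a, Dens \<chi> (- 1 - a)\<rbrace>, Dens \<psi> a\<rbrace>)
        + smult \<epsilon>2 (coef \<lbrace>deRham \<lbrace>Dens \<psi> a, Dens \<chi> (- 1 - a)\<rbrace>, Dens \<phi> a\<rbrace>)"
proof -
  define t where "t = - 1 - a"
  have nz: "a \<noteq> 0" "t \<noteq> 0" "a - t \<noteq> 0" using a t at by (simp_all add: t_def)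
  define \<epsilon>1 \<epsilon>2 where "\<epsilon>1 = \<alpha> 3 0 0 / (a * t)" and "\<epsilon>2 = \<alpha> 0 3 0 / (a * t)"
  have A: "\<alpha> 3 0 0 = a * t * \<epsilon>1" "\<alpha> 0 3 0 = a * t * \<epsilon>2"
    using nz by (simp_all add: \<epsilon>1_def \<epsilon>2_def)
  note r = reduced_system[OF sol, folded t_def, unfolded A]
  have "a * a * (a - t) * (\<alpha> 2 1 0 - - t * \<epsilon>1) = 0" using r(8) unfolding t_def by algebra
  then have p: "\<alpha> 2 1 0 = - t * \<epsilon>1" using nz by simp
  note r' = r[unfolded p]
  have "t * (\<alpha> 0 0 3 - (- a * a * \<epsilon>1 - a * a * \<epsilon>2)) = 0" using r'(1) unfolding t_def by algebra
  moreover have "a * t * (\<alpha> 2 0 1 - a * (2 * t - a) * \<epsilon>1) = 0" using r'(2) unfolding t_def by algebra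
  moreover have "a * t * (\<alpha> 0 2 1 - a * (2 * t - a) * \<epsilon>2) = 0" using r'(3) unfolding t_def by algebra
  moreover have "a * a * (\<alpha> 1 2 0 - - t * \<epsilon>2) = 0" using r'(4) unfolding t_def by algebra
  moreover have "a * t * (\<alpha> 1 0 2 - (a * (t - 2 * a) * \<epsilon>1 + a * \<epsilon>2)) = 0" using r'(5) unfolding t_def by algebra
  moreover have "a * t * (\<alpha> 0 1 2 - (a * \<epsilon>1 + a * (t - 2 * a) * \<epsilon>2)) = 0" using r'(6) unfolding t_def by algebra
  moreover have "a * a * t * (\<alpha> 1 1 1 - ((a - t) * \<epsilon>1 + (a - t) * \<epsilon>2)) = 0" using r'(7) unfolding t_def by algebra
  ultimately have c: "\<alpha> 0 0 3 = - a * a * \<epsilon>1 - a * a * \<epsilon>2" "\<alpha> 2 0 1 = a * (2 * t - a) * \<epsilon>1"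
    "\<alpha> 0 2 1 = a * (2 * t - a) * \<epsilon>2" "\<alpha> 1 2 0 = - t * \<epsilon>2"
    "\<alpha> 1 0 2 = a * (t - 2 * a) * \<epsilon>1 + a * \<epsilon>2" "\<alpha> 0 1 2 = a * \<epsilon>1 + a * (t - 2 * a) * \<epsilon>2"
    "\<alpha> 1 1 1 = (a - t) * \<epsilon>1 + (a - t) * \<epsilon>2"
    using nz by (simp_all only: mult_eq_0_iff right_minus_eq simp_thms)
  have "hom_op \<alpha> \<phi> \<psi> \<chi> =
          smult \<epsilon>1 (coef \<lbrace>deRham \<lbrace>Dens \<phi> a, Dens \<chi> (- 1 - a)\<rbrace>, Dens \<psi> a\<rbrace>)
        + smult \<epsilon>2 (coef \<lbrace>deRham \<lbrace>Dens \<psi> a, Dens \<chi> (- 1 - a)\<rbrace>, Dens \<phi> a\<rbrace>)" for \<phi> \<psi> \<chi>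
    by (rule real_poly_eqI)
      (simp only: poly_hom_op A p c t_def, simp add: density_op_simps, simp add: algebra_simps)
  then show ?thesis by blast
qed

section \<open>The classification\<close>

theorem theorem2p3:
  fixes l g t :: real and A :: ternary_map
  assumes "is_diff_op 3 A"
    and "vect_invariant (l, g, t, l + g + t + 3, A)"
  shows "\<exists>l' g' t' m' B. perm_dual (l, g, t, l + g + t + 3, A) (l', g', t', m', B) \<and>
    ( \<comment> \<open>(1)\<close>
      ((g', l', t') = (0, 0, 0) \<and>
       (\<exists>\<epsilon>1 \<epsilon>2 \<epsilon>3 \<epsilon>4. \<forall>\<phi> \<psi> \<chi>. B \<phi> \<psi> \<chi> =
          smult \<epsilon>1 (coef (\<lbrace>deRham (Dens \<phi> l'), deRham (Dens \<psi> g')\<rbrace> \<odot> Dens \<chi> t'))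
        + smult \<epsilon>2 (coef (\<lbrace>deRham (Dens \<chi> t'), deRham (Dens \<phi> l')\<rbrace> \<odot> Dens \<psi> g'))
        + smult \<epsilon>3 (coef (\<lbrace>deRham (Dens \<psi> g'), deRham (Dens \<chi> t')\<rbrace> \<odot> Dens \<phi> l'))
        + smult \<epsilon>4 (coef (deRham (Dens \<phi> l') \<odot> deRham (Dens \<psi> g') \<odot> deRham (Dens \<chi> t')))))
    \<or> \<comment> \<open>(2)\<close>
      (l' = 0 \<and> g'\<^sup>2 + t'\<^sup>2 \<noteq> 0 \<and>
       (\<exists>\<epsilon>1 \<epsilon>2. \<forall>\<phi> \<psi> \<chi>. B \<phi> \<psi> \<chi> =
          smult \<epsilon>1 (coef \<lbrace>\<lbrace>deRham (Dens \<phi> l'), Dens \<psi> g'\<rbrace>, Dens \<chi> t'\<rbrace>)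
        + smult \<epsilon>2 (coef \<lbrace>\<lbrace>deRham (Dens \<phi> l'), Dens \<chi> t'\<rbrace>, Dens \<psi> g'\<rbrace>)))
    \<or> \<comment> \<open>(3)\<close>
      ((g', l', t') = (-2/3, -2/3, -2/3) \<and>
       (\<exists>\<epsilon>1 \<epsilon>2 \<epsilon>3. \<forall>\<phi> \<psi> \<chi>. B \<phi> \<psi> \<chi> =
          smult \<epsilon>1 (coef (Grozman (Dens \<phi> l') (Dens \<psi> g') \<odot> Dens \<chi> t'))
        + smult \<epsilon>2 (coef (Grozman (Dens \<chi> t') (Dens \<phi> l') \<odot> Dens \<psi> g'))
        + smult \<epsilon>3 (coef (Grozman (Dens \<psi> g') (Dens \<chi> t') \<odot> Dens \<phi> l'))))
    \<or> \<comment> \<open>(4)\<close>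
      ((g', l', t') = (-1/2, -1/2, -1/2) \<and>
       (\<exists>\<epsilon>1 \<epsilon>2 \<epsilon>3. \<forall>\<phi> \<psi> \<chi>. B \<phi> \<psi> \<chi> =
          smult \<epsilon>1 (coef \<lbrace>deRham \<lbrace>Dens \<phi> l', Dens \<psi> g'\<rbrace>, Dens \<chi> t'\<rbrace>)
        + smult \<epsilon>2 (coef \<lbrace>deRham \<lbrace>Dens \<chi> t', Dens \<phi> l'\<rbrace>, Dens \<psi> g'\<rbrace>)
        + smult \<epsilon>3 (coef \<lbrace>deRham \<lbrace>Dens \<psi> g', Dens \<chi> t'\<rbrace>, Dens \<phi> l'\<rbrace>)))
    \<or> \<comment> \<open>(5)\<close>
      (1 + l' + t' = 0 \<and> g' = l' \<and> l' \<noteq> t' \<and>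
       (\<exists>\<epsilon>1 \<epsilon>2. \<forall>\<phi> \<psi> \<chi>. B \<phi> \<psi> \<chi> =
          smult \<epsilon>1 (coef \<lbrace>deRham \<lbrace>Dens \<phi> l', Dens \<chi> t'\<rbrace>, Dens \<psi> g'\<rbrace>)
        + smult \<epsilon>2 (coef \<lbrace>deRham \<lbrace>Dens \<psi> g', Dens \<chi> t'\<rbrace>, Dens \<phi> l'\<rbrace>)))
    \<or> \<comment> \<open>(6)\<close>
      ((\<forall>l'' g'' t'' m'' C. perm_dual (l, g, t, l + g + t + 3, A) (l'', g'', t'', m'', C) \<longrightarrow>
          \<not> exceptional l'' g'' t'') \<and>
       (\<exists>c. \<forall>\<phi> \<psi> \<chi>. B \<phi> \<psi> \<chi> = smult c (Delta3 l' g' t' \<phi> \<psi> \<chi>))))"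
proof -
  let ?X = "(l, g, t, l + g + t + 3, A)"
  let ?M = "{#l, g, t, - 2 - l - g - t#}"
  obtain \<alpha> where A: "A = hom_op \<alpha>" and sol: "coeff_system l g t \<alpha>"
    using invariant_imp_hom_op[OF assms] .
  have X: "realizes ?X l g t"
    unfolding realizes_def A using sol by blast
  have rearrange: "\<exists>\<beta>. perm_dual ?X (l', g', t', l' + g' + t' + 3, hom_op \<beta>) \<and> coeff_system l' g' t' \<beta>"
    if "{#l', g', t', - 2 - l' - g' - t'#} = ?M" for l' g' t'
    using realizes_rearranged[OF X that] unfolding realizes_def .
  \<comment> \<open>In each degenerate case, the arrangement of the weights in which the solutions are known explicitly.\<close>
  consider (zeros) "?M = {#0, 0, 0, - 2#}"
    | (deRham) g' t' where "?M = {#0, g', t', - 2 - g' - t'#}" "g' \<noteq> 0" "t' \<noteq> 0" "\<not> (g' = - 2/3 \<and> t' = - 2/3)"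
    | (deRham0) t' where "?M = {#0, 0, t', - 2 - t'#}" "t' \<noteq> 0" "t' \<noteq> - 2"
    | (Grozman) "?M = {#- 2/3, - 2/3, - 2/3, 0#}"
    | (halves) "?M = {#- 1/2, - 1/2, - 1/2, - 1/2#}"
    | (pairs) a where "?M = {#a, a, - 1 - a, - 1 - a#}" "a \<noteq> 0" "- 1 - a \<noteq> 0" "a \<noteq> - 1 - a"
    | (generic) "\<not> degenerate ?M"
  proof (cases "0 \<in># ?M")
    case True
    then consider "l = 0" | "g = 0" | "t = 0" | "t = - 2 - l - g" by fastforce
    then obtain x y where M: "?M = {#0, x, y, - 2 - x - y#}"
    proof cases
      case 1 then show thesis using that[of g t] by simp
    next
      case 2 then show thesis using that[of l t] by (simp add: add_mset_commute)
    next
      case 3 then show thesis using that[of l g] by (simp add: add_mset_commute)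
    next
      case 4 then show thesis using that[of l g] by (simp add: add_mset_commute)
    qed
    consider "x = 0" "y = 0" | "x = 0" "y = - 2" | "x = - 2" "y = 0" | "x = 0" "y \<noteq> 0" "y \<noteq> - 2" | "y = 0" "x \<noteq> 0" "x \<noteq> - 2"
      | "x = - 2/3" "y = - 2/3" | "x \<noteq> 0" "y \<noteq> 0" "\<not> (x = - 2/3 \<and> y = - 2/3)" by blast
    then show thesis
    proof cases
      case 1 then show thesis using zeros M by simp
    next
      case 2 then show thesis using zeros M by (simp add: add_mset_commute)
    next
      case 3 then show thesis using zeros M by (simp add: add_mset_commute)
    next
      case 4 then show thesis using deRham0[of y] M by simp
    next
      case 5 then show thesis using deRham0[of x] M by (simp add: add_mset_commute)
    next
      case 6 then show thesis using Grozman M by (simp add: add_mset_commute)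
    next
      case 7 then show thesis using deRham[of x y] M by simp
    qed
  next
    case False
    show thesis
    proof (cases "\<exists>a. ?M = {#a, a, - 1 - a, - 1 - a#}")
      case True
      then obtain a where a: "?M = {#a, a, - 1 - a, - 1 - a#}" by blast
      have "a \<noteq> 0" "- 1 - a \<noteq> 0" using \<open>0 \<notin># ?M\<close> unfolding a by auto
      show thesis
      proof (cases "a = - 1 - a")
        case True
        then have "a = - 1/2" by simp
        then show thesis using halves unfolding a by simp
      next
        case False
        with \<open>a \<noteq> 0\<close> \<open>- 1 - a \<noteq> 0\<close> show thesis using pairs[OF a] by blast
      qed
    next
      case False
      with \<open>0 \<notin># ?M\<close> show thesis using generic by (simp add: degenerate_def)
    qed
  qed
  then show ?thesis
  proof cases
    case zeros
    then obtain \<beta> where r: "perm_dual ?X (0, 0, 0, 0 + 0 + 0 + 3, hom_op \<beta>)" and s: "coeff_system 0 0 0 \<beta>"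
      using rearrange[of 0 0 0] by auto
    show ?thesis
      by (intro exI, rule conjI[OF r], rule disjI1, rule conjI)
        (rule refl, rule zero_weights_solution[OF s])
  next
    case (deRham g' t')
    then obtain \<beta> where r: "perm_dual ?X (0, g', t', 0 + g' + t' + 3, hom_op \<beta>)" and s: "coeff_system 0 g' t' \<beta>"
      using rearrange[of 0 g' t'] by auto
    have nz: "g'\<^sup>2 + t'\<^sup>2 \<noteq> 0" using deRham(2) by (simp add: sum_power2_eq_zero_iff)
    show ?thesis
      by (intro exI, rule conjI[OF r], rule disjI2, rule disjI1, rule conjI[OF refl],
          rule conjI[OF nz], rule deRham_solution[OF s deRham(2-4)])
  next
    case (deRham0 t')
    then obtain \<beta> where r: "perm_dual ?X (0, 0, t', 0 + 0 + t' + 3, hom_op \<beta>)" and s: "coeff_system 0 0 t' \<beta>"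
      using rearrange[of 0 0 t'] by auto
    have nz: "(0::real)\<^sup>2 + t'\<^sup>2 \<noteq> 0" using deRham0(2) by simp
    show ?thesis
      by (intro exI, rule conjI[OF r], rule disjI2, rule disjI1, rule conjI[OF refl],
          rule conjI[OF nz], rule two_zero_weights_solution[OF s deRham0(2,3)])
  next
    case Grozman
    then obtain \<beta> where r: "perm_dual ?X (- 2/3, - 2/3, - 2/3, - 2/3 + - 2/3 + - 2/3 + 3, hom_op \<beta>)"
      and s: "coeff_system (- 2/3) (- 2/3) (- 2/3) \<beta>"
      using rearrange[of "- 2/3" "- 2/3" "- 2/3"] by auto
    show ?thesis
      by (intro exI, rule conjI[OF r], rule disjI2, rule disjI2, rule disjI1, rule conjI)
        (rule refl, rule Grozman_solution[OF s])
  next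
    case halves
    then obtain \<beta> where r: "perm_dual ?X (- 1/2, - 1/2, - 1/2, - 1/2 + - 1/2 + - 1/2 + 3, hom_op \<beta>)"
      and s: "coeff_system (- 1/2) (- 1/2) (- 1/2) \<beta>"
      using rearrange[of "- 1/2" "- 1/2" "- 1/2"] by auto
    show ?thesis
      by (intro exI, rule conjI[OF r], rule disjI2, rule disjI2, rule disjI2, rule disjI1, rule conjI)
        (rule refl, rule half_weights_solution[OF s])
  next
    case (pairs a)
    then obtain \<beta> where r: "perm_dual ?X (a, a, - 1 - a, a + a + (- 1 - a) + 3, hom_op \<beta>)"
      and s: "coeff_system a a (- 1 - a) \<beta>"
      using rearrange[of a a "- 1 - a"] by auto
    have sum: "1 + a + (- 1 - a) = 0" by simp
    show ?thesis
      by (intro exI, rule conjI[OF r], rule disjI2, rule disjI2, rule disjI2, rule disjI2, rule disjI1,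
          rule conjI[OF sum], rule conjI[OF refl], rule conjI[OF pairs(4)], rule paired_weights_solution[OF s pairs(2-4)])
  next
    case generic
    then have nz: "l \<noteq> 0" "g \<noteq> 0" "t \<noteq> 0" "- 2 - l - g - t \<noteq> 0"
      and pairs: "\<nexists>a. ?M = {#a, a, - 1 - a, - 1 - a#}"
      by (auto simp: degenerate_def)
    obtain c where "A = hom_op (\<lambda>i j n. c * Delta3_coeffs l g t i j n)"
      using generic_solution[OF sol nz pairs] A by blast
    then have Delta: "\<forall>\<phi> \<psi> \<chi>. A \<phi> \<psi> \<chi> = smult c (Delta3 l g t \<phi> \<psi> \<chi>)"
      by (intro allI real_poly_eqI) (simp add: Delta3_eq_hom_op poly_hom_op algebra_simps)
    have none: "\<forall>l'' g'' t'' m'' C. perm_dual ?X (l'', g'', t'', m'', C) \<longrightarrow> \<not> exceptional l'' g'' t''"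
      using reachable_exceptional_imp_degenerate generic by blast
    show ?thesis
      by (intro exI, rule conjI[OF rtranclp.rtrancl_refl], (rule disjI2)+,
          rule conjI[OF none], intro exI, rule Delta)
  qed
qed

end
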